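(* Let $p$ and $q$ be distinct primes with $pq\neq 6$ and $q\mid p-1$. Let $r$ be an integer with $r^{q}\equiv 1 \pmod{p}$ and $r\not\equiv 1\pmod{p}$, and let $G=\langle a,b,c,d\mid a^{q}=b^{q}=c^{p}=d^{p}=[a,c]=[a,d]=[a,b]=[c,d]=1,\ b^{-1}cb=c^{r},\ b^{-1}db=d^{r}\rangle$. Then $\mathrm{Aut}(G)\simeq(\mathbb{Z}_{p}\times\mathbb{Z}_{p})\rtimes(GL(2,p)\times(\mathbb{Z}_{q}\rtimes\mathbb{Z}_{q-1}))$.
   Context: $\mathbb{Z}_n$ is the cyclic group of order $n$; $[x,y]=x^{-1}y^{-1}xy$. $X\rtimes Y$ denotes a semidirect product with normal subgroup $X$ with respect to some homomorphism $Y\to\mathrm{Aut}(X)$; the statement asserts that $\mathrm{Aut}(G)$ is isomorphic to such an (iterated) semidirect product for some choice of actions. *)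

theory Defs
  imports
    "HOL-Number_Theory.Cong"
    "HOL-Algebra.Bij"
    "HOL-Algebra.Elementary_Groups"
    "Jordan_Normal_Form.Matrix"
begin

section \<open>Groups given by generators and relations\<close>

text \<open>A letter is a generator with a sign; \<open>(x, True)\<close> stands for the generator \<open>x\<close> and
  \<open>(x, False)\<close> for its formal inverse.\<close>

type_synonym 'g word = "('g \<times> bool) list"

definition gen_word :: "'g \<Rightarrow> 'g word" where
  "gen_word x = [(x, True)]"

definition word_inv :: "'g word \<Rightarrow> 'g word" where
  "word_inv w = rev (map (\<lambda>(x, s). (x, \<not> s)) w)"

definition word_pow :: "'g word \<Rightarrow> int \<Rightarrow> 'g word" where
  "word_pow w k =
     (if 0 \<le> k then concat (replicate (nat k) w)
      else concat (replicate (nat (- k)) (word_inv w)))"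

definition word_comm :: "'g word \<Rightarrow> 'g word \<Rightarrow> 'g word" where
  "word_comm x y = word_inv x @ word_inv y @ x @ y"

text \<open>The congruence on words generated by free cancellation and by a set \<open>R\<close> of relations, a pair
  \<open>(l, r)\<close> in \<open>R\<close> being read as the relation \<open>l = r\<close>. Its quotient is the free group modulo the
  normal closure of all \<open>l r\<^sup>-\<^sup>1\<close>.\<close>

inductive word_equiv :: "('g word \<times> 'g word) set \<Rightarrow> 'g word \<Rightarrow> 'g word \<Rightarrow> bool"
  for R where
  refl: "word_equiv R u u"
| sym: "word_equiv R u v \<Longrightarrow> word_equiv R v u"
| trans: "word_equiv R u v \<Longrightarrow> word_equiv R v w \<Longrightarrow> word_equiv R u w"
| cancel: "word_equiv R (u @ [(x, s), (x, \<not> s)] @ v) (u @ v)"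
| rel: "(l, r) \<in> R \<Longrightarrow> word_equiv R (u @ l @ v) (u @ r @ v)"

definition word_rel :: "('g word \<times> 'g word) set \<Rightarrow> ('g word \<times> 'g word) set" where
  "word_rel R = {(u, v). word_equiv R u v}"

text \<open>The generators are all elements of the type \<open>'g\<close>.\<close>

definition presented_group :: "('g word \<times> 'g word) set \<Rightarrow> 'g word set monoid" where
  "presented_group R =
     \<lparr>carrier = UNIV // word_rel R,
      mult = (\<lambda>X Y. \<Union>x\<in>X. \<Union>y\<in>Y. word_rel R `` {x @ y}),
      one = word_rel R `` {[]}\<rparr>"

lemma equiv_word_rel: "equiv UNIV (word_rel R)"
  unfolding word_rel_def
  by (rule equivI) (auto simp: refl_on_def sym_def trans_def
      intro: word_equiv.refl word_equiv.sym word_equiv.trans)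

lemma word_equiv_append_left: "word_equiv R u v \<Longrightarrow> word_equiv R (w @ u) (w @ v)"
proof (induction rule: word_equiv.induct)
  case (cancel u x s v)
  show ?case using word_equiv.cancel[of R "w @ u" x s v] by simp
next
  case (rel l r u v)
  then show ?case using word_equiv.rel[of l r R "w @ u" v] by simp
qed (auto intro: word_equiv.intros)

lemma word_equiv_append_right: "word_equiv R u v \<Longrightarrow> word_equiv R (u @ w) (v @ w)"
proof (induction rule: word_equiv.induct)
  case (cancel u x s v)
  show ?case using word_equiv.cancel[of R u x s "v @ w"] by simp
next
  case (rel l r u v)
  then show ?case using word_equiv.rel[of l r R u "v @ w"] by simp
qed (auto intro: word_equiv.intros)

lemma word_equiv_append:
  "word_equiv R u u' \<Longrightarrow> word_equiv R v v' \<Longrightarrow> word_equiv R (u @ v) (u' @ v')"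
  by (meson word_equiv.trans word_equiv_append_left word_equiv_append_right)

lemma word_equiv_inv_left: "word_equiv R (word_inv w @ w) []"
proof (induction w)
  case Nil
  show ?case by (simp add: word_inv_def word_equiv.refl)
next
  case (Cons a w)
  obtain x s where a: "a = (x, s)" by force
  have "word_equiv R (word_inv (a # w) @ a # w) (word_inv w @ w)"
    using word_equiv.cancel[of R "word_inv w" x "\<not> s" w] by (simp add: a word_inv_def)
  then show ?case using Cons.IH by (rule word_equiv.trans)
qed

lemma presented_group_mult_class:
  "(word_rel R `` {u}) \<otimes>\<^bsub>presented_group R\<^esub> (word_rel R `` {v}) = word_rel R `` {u @ v}"
proof -
  have "congruent2 (word_rel R) (word_rel R) (\<lambda>x y. word_rel R `` {x @ y})"
  proof (rule congruent2I[OF equiv_word_rel equiv_word_rel])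
    fix u v w assume "(u, v) \<in> word_rel R"
    then have "word_equiv R u v" by (simp add: word_rel_def)
    then have "(u @ w, v @ w) \<in> word_rel R" "(w @ u, w @ v) \<in> word_rel R"
      by (simp_all add: word_rel_def word_equiv_append_left word_equiv_append_right)
    from this[THEN equiv_class_eq[OF equiv_word_rel]]
    show "word_rel R `` {u @ w} = word_rel R `` {v @ w}"
      and "word_rel R `` {w @ u} = word_rel R `` {w @ v}"
      .
  qed
  from UN_equiv_class2[OF equiv_word_rel equiv_word_rel this]
  show ?thesis by (simp add: presented_group_def)
qed

lemma presented_group_is_group: "group (presented_group R)"
proof (rule groupI)
  have carr: "carrier (presented_group R) = range (\<lambda>u. word_rel R `` {u})"
    by (auto simp: presented_group_def quotient_def)
  have one: "\<one>\<^bsub>presented_group R\<^esub> = word_rel R `` {[]}"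
    by (simp add: presented_group_def)
  note s = carr one presented_group_mult_class
  show "\<one>\<^bsub>presented_group R\<^esub> \<in> carrier (presented_group R)" by (auto simp: s)
  fix x assume x: "x \<in> carrier (presented_group R)"
  then obtain u where u: "x = word_rel R `` {u}" by (auto simp: carr)
  show "\<one>\<^bsub>presented_group R\<^esub> \<otimes>\<^bsub>presented_group R\<^esub> x = x"
    unfolding u one presented_group_mult_class by simp
  have "word_rel R `` {word_inv u} \<otimes>\<^bsub>presented_group R\<^esub> x = \<one>\<^bsub>presented_group R\<^esub>"
    unfolding u one presented_group_mult_class
    by (rule equiv_class_eq[OF equiv_word_rel]) (simp add: word_rel_def word_equiv_inv_left)
  then show "\<exists>y\<in>carrier (presented_group R). y \<otimes>\<^bsub>presented_group R\<^esub> x = \<one>\<^bsub>presented_group R\<^esub>"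
    by (auto simp: carr)
  fix y assume "y \<in> carrier (presented_group R)"
  then obtain v where v: "y = word_rel R `` {v}" by (auto simp: carr)
  show "x \<otimes>\<^bsub>presented_group R\<^esub> y \<in> carrier (presented_group R)"
    unfolding u v presented_group_mult_class carr by blast
  fix z assume "z \<in> carrier (presented_group R)"
  then obtain w where w: "z = word_rel R `` {w}" by (auto simp: carr)
  show "x \<otimes>\<^bsub>presented_group R\<^esub> y \<otimes>\<^bsub>presented_group R\<^esub> z
      = x \<otimes>\<^bsub>presented_group R\<^esub> (y \<otimes>\<^bsub>presented_group R\<^esub> z)"
    unfolding u v w presented_group_mult_class by simp
qed

datatype gen = GenA | GenB | GenC | GenD

definition relations_G :: "nat \<Rightarrow> nat \<Rightarrow> int \<Rightarrow> (gen word \<times> gen word) set" where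
  "relations_G p q r =
     (let a = gen_word GenA; b = gen_word GenB; c = gen_word GenC; d = gen_word GenD in
      {(word_pow a (int q), []), (word_pow b (int q), []),
       (word_pow c (int p), []), (word_pow d (int p), []),
       (word_comm a c, []), (word_comm a d, []), (word_comm a b, []), (word_comm c d, []),
       (word_inv b @ c @ b, word_pow c r),
       (word_inv b @ d @ b, word_pow d r)})"

definition G_pres :: "nat \<Rightarrow> nat \<Rightarrow> int \<Rightarrow> gen word set monoid" where
  "G_pres p q r = presented_group (relations_G p q r)"


section \<open>Semidirect products\<close>

definition semidirect ::
    "('a, 'm) monoid_scheme \<Rightarrow> ('b, 'n) monoid_scheme \<Rightarrow> ('b \<Rightarrow> 'a \<Rightarrow> 'a) \<Rightarrow> ('a \<times> 'b) monoid" where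
  "semidirect N H \<phi> =
     \<lparr>carrier = carrier N \<times> carrier H,
      mult = (\<lambda>(n, h) (n', h'). (n \<otimes>\<^bsub>N\<^esub> \<phi> h n', h \<otimes>\<^bsub>H\<^esub> h')),
      one = (\<one>\<^bsub>N\<^esub>, \<one>\<^bsub>H\<^esub>)\<rparr>"

lemma semidirect_is_group:
  assumes "group N" "group H" and \<phi>: "\<phi> \<in> hom H (AutoGroup N)"
  shows "group (semidirect N H \<phi>)"
proof -
  interpret N: group N by fact
  interpret H: group H by fact
  interpret A: group "AutoGroup N" by (rule N.AutoGroup)
  interpret \<phi>: group_hom H "AutoGroup N" \<phi>
    by unfold_locales (rule \<phi>)
  have aut: "\<phi> h \<in> auto N" if "h \<in> carrier H" for h
    using \<phi>.hom_closed[OF that] by (simp add: AutoGroup_def)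
  have closed: "\<phi> h n \<in> carrier N" if "h \<in> carrier H" "n \<in> carrier N" for h n
    using aut[OF that(1)] that(2) by (auto simp: auto_def hom_def)
  have mult: "\<phi> h (n \<otimes>\<^bsub>N\<^esub> n') = \<phi> h n \<otimes>\<^bsub>N\<^esub> \<phi> h n'"
    if "h \<in> carrier H" "n \<in> carrier N" "n' \<in> carrier N" for h n n'
    using aut[OF that(1)] that(2,3) by (auto simp: auto_def hom_def)
  have comp: "\<phi> (h \<otimes>\<^bsub>H\<^esub> h') n = \<phi> h (\<phi> h' n)"
    if "h \<in> carrier H" "h' \<in> carrier H" "n \<in> carrier N" for h h' n
    using \<phi>.hom_mult[OF that(1,2)] aut[OF that(1)] aut[OF that(2)] that(3)
    by (simp add: AutoGroup_def BijGroup_def auto_def compose_def)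
  have id: "\<phi> \<one>\<^bsub>H\<^esub> n = n" if "n \<in> carrier N" for n
    using \<phi>.hom_one that by (simp add: AutoGroup_def BijGroup_def)
  show ?thesis
  proof (rule groupI)
    fix x assume "x \<in> carrier (semidirect N H \<phi>)"
    then obtain n h where x: "x = (n, h)" "n \<in> carrier N" "h \<in> carrier H"
      by (auto simp: semidirect_def)
    let ?y = "(\<phi> (inv\<^bsub>H\<^esub> h) (inv\<^bsub>N\<^esub> n), inv\<^bsub>H\<^esub> h)"
    have "\<phi> (inv\<^bsub>H\<^esub> h) (inv\<^bsub>N\<^esub> n) \<otimes>\<^bsub>N\<^esub> \<phi> (inv\<^bsub>H\<^esub> h) n = \<phi> (inv\<^bsub>H\<^esub> h) \<one>\<^bsub>N\<^esub>"
      using x mult[of "inv\<^bsub>H\<^esub> h" "inv\<^bsub>N\<^esub> n" n] by simp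
    also have "\<dots> = \<one>\<^bsub>N\<^esub>"
      using x mult[of "inv\<^bsub>H\<^esub> h" "\<one>\<^bsub>N\<^esub>" "\<one>\<^bsub>N\<^esub>"] closed[of "inv\<^bsub>H\<^esub> h" "\<one>\<^bsub>N\<^esub>"]
      by (simp add: N.r_cancel_one)
    finally have "?y \<otimes>\<^bsub>semidirect N H \<phi>\<^esub> x = \<one>\<^bsub>semidirect N H \<phi>\<^esub>"
      using x by (simp add: semidirect_def)
    moreover have "?y \<in> carrier (semidirect N H \<phi>)"
      using x closed[of "inv\<^bsub>H\<^esub> h" "inv\<^bsub>N\<^esub> n"] by (simp add: semidirect_def del: \<phi>.hom_inv)
    ultimately show "\<exists>y\<in>carrier (semidirect N H \<phi>). y \<otimes>\<^bsub>semidirect N H \<phi>\<^esub> x = \<one>\<^bsub>semidirect N H \<phi>\<^esub>"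
      by blast
  qed (auto simp: semidirect_def closed mult comp id N.m_assoc H.m_assoc
      simp del: \<phi>.hom_mult \<phi>.hom_one)
qed


section \<open>The general linear group over the integers modulo m\<close>

text \<open>Entries are represented by their residues in \<open>{0..<m}\<close>.\<close>

definition mat_mod_monoid :: "nat \<Rightarrow> nat \<Rightarrow> int mat monoid" where
  "mat_mod_monoid n m =
     \<lparr>carrier = {A \<in> carrier_mat n n. \<forall>i<n. \<forall>j<n. A $$ (i, j) \<in> {0..<int m}},
      mult = (\<lambda>A B. map_mat (\<lambda>x. x mod int m) (A * B)),
      one = map_mat (\<lambda>x. x mod int m) (1\<^sub>m n)\<rparr>"

definition GL :: "nat \<Rightarrow> nat \<Rightarrow> int mat monoid" where
  "GL n m = units_of (mat_mod_monoid n m)"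

lemma map_mat_mod_mult:
  fixes A B :: "int mat"
  assumes "A \<in> carrier_mat n n" "B \<in> carrier_mat n n"
  shows "map_mat (\<lambda>x. x mod m) (map_mat (\<lambda>x. x mod m) A * B) = map_mat (\<lambda>x. x mod m) (A * B)"
    and "map_mat (\<lambda>x. x mod m) (A * map_mat (\<lambda>x. x mod m) B) = map_mat (\<lambda>x. x mod m) (A * B)"
proof -
  have *: "(\<Sum>k<n. f k * g k) mod m = (\<Sum>k<n. f' k * g' k) mod m"
    if "\<And>k. k < n \<Longrightarrow> (f k * g k) mod m = (f' k * g' k) mod m" for f g f' g' :: "nat \<Rightarrow> int"
    using that by (subst (1 2) mod_sum_eq[symmetric]) simp
  show "map_mat (\<lambda>x. x mod m) (map_mat (\<lambda>x. x mod m) A * B) = map_mat (\<lambda>x. x mod m) (A * B)"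
    "map_mat (\<lambda>x. x mod m) (A * map_mat (\<lambda>x. x mod m) B) = map_mat (\<lambda>x. x mod m) (A * B)"
    using assms
    by (auto intro!: eq_matI * simp: scalar_prod_def atLeast0LessThan mod_simps)
qed

lemma mat_mod_monoid_is_monoid:
  assumes "m > 0"
  shows "monoid (mat_mod_monoid n m)"
proof
  let ?M = "mat_mod_monoid n m"
  have red: "map_mat (\<lambda>x. x mod int m) A = A" if "A \<in> carrier ?M" for A
    using that by (auto simp: mat_mod_monoid_def intro!: eq_matI)
  have carr: "A \<in> carrier_mat n n" if "A \<in> carrier ?M" for A
    using that by (auto simp: mat_mod_monoid_def)
  fix A assume A: "A \<in> carrier ?M"
  show "\<one>\<^bsub>?M\<^esub> \<otimes>\<^bsub>?M\<^esub> A = A" "A \<otimes>\<^bsub>?M\<^esub> \<one>\<^bsub>?M\<^esub> = A"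
    using carr[OF A] red[OF A] by (simp_all add: mat_mod_monoid_def map_mat_mod_mult[where n = n])
  fix B assume B: "B \<in> carrier ?M"
  show "A \<otimes>\<^bsub>?M\<^esub> B \<in> carrier ?M"
    using carr[OF A] carr[OF B] assms by (auto simp: mat_mod_monoid_def)
  fix C assume C: "C \<in> carrier ?M"
  show "A \<otimes>\<^bsub>?M\<^esub> B \<otimes>\<^bsub>?M\<^esub> C = A \<otimes>\<^bsub>?M\<^esub> (B \<otimes>\<^bsub>?M\<^esub> C)"
    using carr[OF A] carr[OF B] carr[OF C]
    by (simp add: mat_mod_monoid_def map_mat_mod_mult[where n = n] assoc_mult_mat[of _ n n _ n _ n])
next
  show "\<one>\<^bsub>mat_mod_monoid n m\<^esub> \<in> carrier (mat_mod_monoid n m)"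
    using assms by (auto simp: mat_mod_monoid_def)
qed

lemma GL_is_group: "m > 0 \<Longrightarrow> group (GL n m)"
  unfolding GL_def by (rule monoid.units_group[OF mat_mod_monoid_is_monoid])

end

theory Submission
  imports Defs "HOL-Number_Theory.Residue_Primitive_Roots"
begin

text \<open>The group \<open>G\<close> is the product of the central subgroup generated by \<open>a\<close> with
  \<open>N \<rtimes> \<langle>b\<rangle>\<close>, where \<open>N\<close>, generated by \<open>c\<close> and \<open>d\<close>, is a plane over the field with \<open>p\<close>
  elements on which \<open>b\<close> acts as the scalar \<open>r\<close>, of multiplicative order exactly \<open>q\<close>. An
  automorphism \<open>f\<close> preserves \<open>N\<close>, the set of elements killed by \<open>p\<close> (\<open>torsion_in_N\<close>), and the
  centre \<open>\<langle>a\<rangle>\<close> (\<open>center_K\<close>). It therefore restricts to an invertible matrix \<open>M\<close> on \<open>N\<close> and sends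
  \<open>a\<close> to \<open>a\<^sup>i\<close> with \<open>i\<close> prime to \<open>q\<close>. Because \<open>M\<close> commutes with scalars, \<open>f b\<close> has to act on \<open>N\<close>
  by the same scalar as \<open>b\<close>, so \<open>f b = a\<^sup>j b n\<close> with \<open>n\<close> in \<open>N\<close>. Conversely every such choice of
  \<open>(i, j, M, n)\<close> gives an automorphism.

  The composition law becomes a semidirect product once \<open>n\<close> is written as \<open>(1 - r) w\<close>, which is
  possible because \<open>1 - r\<close> is invertible modulo \<open>p\<close>: the parameter \<open>w\<close> then describes an inner
  automorphism induced by \<open>N\<close>, and these form the normal factor \<open>\<int>\<^sub>p \<times> \<int>\<^sub>p\<close>, on which \<open>M\<close> acts
  linearly and \<open>(j, i)\<close> trivially. The pairs \<open>(j, i)\<close> compose like the maps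
  \<open>x \<mapsto> i x + j\<close> of \<open>\<int>\<^sub>q\<close>, and a primitive root modulo \<open>q\<close> identifies the group of the \<open>i\<close> with
  \<open>\<int>\<^bsub>q - 1\<^esub>\<close>.

  The computation takes place in the group \<open>K\<close> of normal forms \<open>a\<^sup>s b\<^sup>t c\<^sup>x d\<^sup>y\<close>, which is isomorphic to
  the presented group (\<open>G_pres_iso_K\<close>). There \<open>act\<close> is the automorphism with given parameters,
  \<open>act_act\<close> is the composition law, \<open>act_inject\<close> says that the parameters are determined by the
  automorphism, and \<open>auto_is_act_unit\<close> that every automorphism arises.\<close>

section \<open>Automorphism groups\<close>

lemma mult_AutoGroup:
  "f \<in> auto G \<Longrightarrow> g \<in> auto G \<Longrightarrow> f \<otimes>\<^bsub>AutoGroup G\<^esub> g = compose (carrier G) f g"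
  by (simp add: AutoGroup_def BijGroup_def auto_def)

text \<open>Bijectivity need not be checked: \<open>f\<close> of the inverse element is an inverse map.\<close>

lemma hom_AutoGroupI:
  assumes "group H" "group N"
    and ext: "\<And>h. h \<in> carrier H \<Longrightarrow> f h \<in> extensional (carrier N)"
    and hom: "\<And>h. h \<in> carrier H \<Longrightarrow> f h \<in> hom N N"
    and one: "\<And>n. n \<in> carrier N \<Longrightarrow> f \<one>\<^bsub>H\<^esub> n = n"
    and comp: "\<And>h h' n. h \<in> carrier H \<Longrightarrow> h' \<in> carrier H \<Longrightarrow> n \<in> carrier N \<Longrightarrow>
                 f (h \<otimes>\<^bsub>H\<^esub> h') n = f h (f h' n)"
  shows "f \<in> hom H (AutoGroup N)"
proof -
  interpret H: group H by fact
  interpret N: group N by fact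
  have closed: "f h n \<in> carrier N" if "h \<in> carrier H" "n \<in> carrier N" for h n
    using hom[OF that(1)] that(2) by (auto simp: hom_def)
  have aut: "f h \<in> auto N" if h: "h \<in> carrier H" for h
  proof -
    have "bij_betw (f h) (carrier N) (carrier N)"
    proof (rule bij_betw_byWitness[where f' = "f (inv\<^bsub>H\<^esub> h)"])
      show "\<forall>n\<in>carrier N. f (inv\<^bsub>H\<^esub> h) (f h n) = n"
        using comp[of "inv\<^bsub>H\<^esub> h" h] one h by simp
      show "\<forall>n\<in>carrier N. f h (f (inv\<^bsub>H\<^esub> h) n) = n"
        using comp[of h "inv\<^bsub>H\<^esub> h"] one h by simp
    qed (use closed h in auto)
    then show ?thesis using hom[OF h] ext[OF h] by (simp add: auto_def Bij_def)
  qed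
  show ?thesis
  proof (rule homI)
    fix h h' assume hh: "h \<in> carrier H" "h' \<in> carrier H"
    show "f (h \<otimes>\<^bsub>H\<^esub> h') = f h \<otimes>\<^bsub>AutoGroup N\<^esub> f h'"
      unfolding mult_AutoGroup[OF aut[OF hh(1)] aut[OF hh(2)]]
      by (rule extensionalityI[where A = "carrier N"])
         (use hh ext comp in \<open>auto simp: compose_def\<close>)
  qed (simp add: AutoGroup_def aut)
qed

text \<open>Conjugation by the given isomorphism carries automorphisms of one group to automorphisms of the other.\<close>

lemma AutoGroup_cong:
  assumes "group G" "group H" and h: "h \<in> iso G H"
  shows "AutoGroup G \<cong> AutoGroup H"
proof -
  interpret G: group G by fact
  interpret H: group H by fact
  define k where "k = inv_into (carrier G) h"
  have k: "k \<in> iso H G" unfolding k_def by (rule G.iso_set_sym[OF h])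
  have bh: "bij_betw h (carrier G) (carrier H)" using h by (simp add: iso_def)
  have hk: "h (k y) = y" if "y \<in> carrier H" for y
    unfolding k_def using bij_betw_inv_into_right[OF bh that] .
  have kh: "k (h x) = x" if "x \<in> carrier G" for x
    unfolding k_def using bij_betw_inv_into_left[OF bh that] .
  have hc: "h x \<in> carrier H" if "x \<in> carrier G" for x
    using h that by (auto simp: iso_def hom_def)
  have kc: "k x \<in> carrier G" if "x \<in> carrier H" for x
    using k that by (auto simp: iso_def hom_def)
  have ac: "f x \<in> carrier L" if "f \<in> auto L" "x \<in> carrier L" for f x and L :: "('z, 'y) monoid_scheme"
    using that by (auto simp: auto_def hom_def)
  have conj: "restrict (\<lambda>x. m (f (n x))) (carrier L) \<in> auto L"
    if "group L" and f: "f \<in> auto M" and m: "m \<in> iso M L" and n: "n \<in> iso L M"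
    for f m n and M :: "('z, 'y) monoid_scheme" and L :: "('w, 'v) monoid_scheme"
  proof -
    have "m \<circ> (f \<circ> n) \<in> iso L L"
      using f m n by (intro iso_set_trans[OF iso_set_trans[OF n] m])
        (auto simp: auto_def Bij_def iso_def)
    then have "bij_betw (\<lambda>x. m (f (n x))) (carrier L) (carrier L)"
      and hom: "(\<lambda>x. m (f (n x))) \<in> hom L L"
      by (simp_all add: iso_def o_def)
    then have bij: "bij_betw (restrict (\<lambda>x. m (f (n x))) (carrier L)) (carrier L) (carrier L)"
      by (simp cong: bij_betw_cong)
    have "x \<otimes>\<^bsub>L\<^esub> y \<in> carrier L" if "x \<in> carrier L" "y \<in> carrier L" for x y
      using \<open>group L\<close> that by (simp add: group.is_monoid monoid.m_closed)
    then have "restrict (\<lambda>x. m (f (n x))) (carrier L) \<in> hom L L"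
      using hom by (auto simp: hom_def)
    with bij show ?thesis by (simp add: auto_def Bij_def)
  qed
  let ?c = "\<lambda>f. restrict (\<lambda>y. h (f (k y))) (carrier H)"
  let ?d = "\<lambda>f. restrict (\<lambda>x. k (f (h x))) (carrier G)"
  have "?c \<in> iso (AutoGroup G) (AutoGroup H)"
  proof (rule isoI)
    show "?c \<in> hom (AutoGroup G) (AutoGroup H)"
    proof (rule homI)
      fix f g assume "f \<in> carrier (AutoGroup G)" "g \<in> carrier (AutoGroup G)"
      then have fg: "f \<in> auto G" "g \<in> auto G" by (simp_all add: AutoGroup_def)
      show "?c (f \<otimes>\<^bsub>AutoGroup G\<^esub> g) = ?c f \<otimes>\<^bsub>AutoGroup H\<^esub> ?c g"
        unfolding mult_AutoGroup[OF fg] mult_AutoGroup[OF fg(1)[THEN conj[OF H.is_group _ h k]] fg(2)[THEN conj[OF H.is_group _ h k]]]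
        by (auto simp: fun_eq_iff compose_def kh hc kc ac fg)
    qed (use conj[OF H.is_group _ h k] in \<open>auto simp: AutoGroup_def\<close>)
    have ext: "f x = undefined" if "f \<in> auto L" "x \<notin> carrier L" for f x and L :: "('z, 'y) monoid_scheme"
      using that by (auto simp: auto_def Bij_def extensional_def)
    show "bij_betw ?c (carrier (AutoGroup G)) (carrier (AutoGroup H))"
      by (rule bij_betw_byWitness[where f' = ?d])
         (use conj[OF H.is_group _ h k] conj[OF G.is_group _ k h] in
           \<open>auto simp: AutoGroup_def fun_eq_iff hk kh hc kc ac ext\<close>)
  qed
  then show ?thesis by (rule is_isoI)
qed

section \<open>Evaluating words\<close>

definition eval_word :: "('h, 'm) monoid_scheme \<Rightarrow> ('g \<Rightarrow> 'h) \<Rightarrow> 'g word \<Rightarrow> 'h" where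
  "eval_word H g w = foldr (\<lambda>(x, s) h. (if s then g x else inv\<^bsub>H\<^esub> (g x)) \<otimes>\<^bsub>H\<^esub> h) w \<one>\<^bsub>H\<^esub>"

context group
begin

context
  fixes g :: "'g \<Rightarrow> 'a"
  assumes g: "\<And>x. g x \<in> carrier G"
begin

lemma eval_word_simps [simp]:
  "eval_word G g [] = \<one>"
  "eval_word G g ((x, s) # w) = (if s then g x else inv (g x)) \<otimes> eval_word G g w"
  by (simp_all add: eval_word_def)

lemma eval_word_closed [simp]: "eval_word G g w \<in> carrier G"
  by (induction w) (auto simp: g)

lemma eval_word_append: "eval_word G g (u @ v) = eval_word G g u \<otimes> eval_word G g v"
  by (induction u) (auto simp: g m_assoc)

lemma eval_word_inv: "eval_word G g (word_inv w) = inv (eval_word G g w)"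
  by (induction w) (auto simp: word_inv_def eval_word_append g inv_mult_group)

lemma eval_word_pow: "eval_word G g (word_pow w k) = eval_word G g w [^] k"
proof -
  have "eval_word G g (concat (replicate n u)) = eval_word G g u [^] n" for n u
  proof (induction n)
    case (Suc n)
    then show ?case
      using nat_pow_Suc2[OF eval_word_closed, of u n] by (simp add: eval_word_append)
  qed simp
  then show ?thesis
    unfolding word_pow_def int_pow_def2 using nat_pow_inv[OF eval_word_closed]
    by (simp add: eval_word_inv not_le)
qed

lemma eval_word_comm:
  "eval_word G g (word_comm u v) =
     inv (eval_word G g u) \<otimes> inv (eval_word G g v) \<otimes> eval_word G g u \<otimes> eval_word G g v"
  by (simp add: word_comm_def eval_word_append eval_word_inv m_assoc)

text \<open>The substance of the universal property of a presentation: evaluation is constant on the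
  congruence generated by relations that hold in the target group.\<close>

lemma eval_word_equiv:
  assumes "\<And>l r. (l, r) \<in> R \<Longrightarrow> eval_word G g l = eval_word G g r"
    and "word_equiv R u v"
  shows "eval_word G g u = eval_word G g v"
  using assms(2)
proof induction
  case (cancel u x s v)
  have "g x \<otimes> (inv g x \<otimes> h) = h" "inv g x \<otimes> (g x \<otimes> h) = h" if "h \<in> carrier G" for h
    using that g[of x] by (metis inv_closed l_inv l_one m_assoc r_inv)+
  then show ?case by (cases s) (simp_all add: eval_word_append)
next
  case (rel l r u v)
  then show ?case using assms(1)[OF rel] by (simp add: eval_word_append)
next
  case (trans u v w)
  then show ?case by simp
qed (simp, erule HOL.sym)

end

end

lemma carrier_presented_group: "carrier (presented_group R) = range (\<lambda>u. word_rel R `` {u})"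
  by (auto simp: presented_group_def quotient_def)

lemma one_presented_group: "\<one>\<^bsub>presented_group R\<^esub> = word_rel R `` {[]}"
  by (simp add: presented_group_def)

lemma word_class_eqI: "word_equiv R u v \<Longrightarrow> word_rel R `` {u} = word_rel R `` {v}"
  by (rule equiv_class_eq[OF equiv_word_rel]) (simp add: word_rel_def)

text \<open>In the presented group itself evaluation is the quotient map, so the rules for evaluating powers,
  inverses and commutators turn each defining relation into an equation between group elements.\<close>

lemma eval_word_presented_group:
  "eval_word (presented_group R) (\<lambda>x. word_rel R `` {gen_word x}) w = word_rel R `` {w}"
proof (induction w)
  case Nil
  show ?case by (simp add: eval_word_def one_presented_group)
next
  case (Cons a w)
  obtain x s where a: "a = (x, s)" by force
  interpret P: group "presented_group R" by (rule presented_group_is_group)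
  have "inv\<^bsub>presented_group R\<^esub> (word_rel R `` {gen_word x}) = word_rel R `` {word_inv (gen_word x)}"
  proof (rule P.inv_equality)
    show "word_rel R `` {word_inv (gen_word x)} \<otimes>\<^bsub>presented_group R\<^esub> word_rel R `` {gen_word x}
        = \<one>\<^bsub>presented_group R\<^esub>"
      unfolding presented_group_mult_class one_presented_group
      by (rule word_class_eqI) (rule word_equiv_inv_left)
  qed (unfold carrier_presented_group, blast+)
  then have "(if s then word_rel R `` {gen_word x} else inv\<^bsub>presented_group R\<^esub> (word_rel R `` {gen_word x}))
      = word_rel R `` {[a]}"
    by (simp add: a gen_word_def word_inv_def)
  then show ?case
    using Cons.IH by (simp add: eval_word_def presented_group_mult_class a)
qed

text \<open>Instead of injectivity one supplies \<open>n\<close>, which names the class of a word from its value alone: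
  a normal form for elements of the presented group.\<close>

lemma iso_presented_groupI:
  assumes "group H" and g: "\<And>x. g x \<in> carrier H"
    and rels: "\<And>l r. (l, r) \<in> R \<Longrightarrow> eval_word H g l = eval_word H g r"
    and surj: "\<And>h. h \<in> carrier H \<Longrightarrow> \<exists>w. eval_word H g w = h"
    and n: "\<And>w. n (eval_word H g w) = word_rel R `` {w}"
  shows "\<exists>f. f \<in> iso (presented_group R) H"
proof -
  interpret H: group H by fact
  define f where "f X = eval_word H g (SOME w. w \<in> X)" for X
  have f: "f (word_rel R `` {w}) = eval_word H g w" for w
  proof -
    have "(SOME v. v \<in> word_rel R `` {w}) \<in> word_rel R `` {w}"
      by (rule someI[of _ w]) (simp add: word_rel_def word_equiv.refl)
    then have "word_equiv R w (SOME v. v \<in> word_rel R `` {w})" by (simp add: word_rel_def)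
    from H.eval_word_equiv[OF g rels this] show ?thesis by (simp add: f_def)
  qed
  have "f \<in> iso (presented_group R) H"
  proof (rule isoI)
    show "f \<in> hom (presented_group R) H"
      by (rule homI) (auto simp: carrier_presented_group f presented_group_mult_class g
          H.eval_word_append H.eval_word_closed)
    show "bij_betw f (carrier (presented_group R)) (carrier H)"
    proof (rule bij_betw_byWitness[where f' = n])
      show "\<forall>X\<in>carrier (presented_group R). n (f X) = X"
        by (auto simp: carrier_presented_group f n)
      have "n h \<in> carrier (presented_group R) \<and> f (n h) = h" if h: "h \<in> carrier H" for h
      proof -
        obtain w where "h = eval_word H g w" using surj[OF h] by blast
        then show ?thesis by (simp only: carrier_presented_group f n) simp
      qed
      then show "\<forall>h\<in>carrier H. f (n h) = h" and "n ` carrier H \<subseteq> carrier (presented_group R)"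
        by blast+
      show "f ` carrier (presented_group R) \<subseteq> carrier H"
        by (auto simp: carrier_presented_group f g H.eval_word_closed)
    qed
  qed
  then show ?thesis by blast
qed

section \<open>A concrete model of the group\<close>

text \<open>Congruences between nested residues are reduced to divisibility: once every \<open>x mod m\<close> is written as
  \<open>x - m * (x div m)\<close>, the difference of the two sides expands into visible multiples of \<open>m\<close>.\<close>

lemma mod_eqI: "m dvd a - b \<Longrightarrow> a mod m = b mod m" for m a b :: int
  by (simp add: mod_eq_dvd_iff)

lemmas expand_mod = minus_mult_div_eq_mod[symmetric]

locale scalar_ext =
  fixes p q :: nat and r :: int
  assumes prime_p: "prime p" and prime_q: "prime q" and p_neq_q: "p \<noteq> q"
    and r_pow_q: "[r ^ q = 1] (mod int p)" and r_neq_1: "\<not> [r = 1] (mod int p)"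
begin

lemma p_gt_1: "int p > 1" and q_gt_1: "int q > 1"
  using prime_gt_1_nat[OF prime_p] prime_gt_1_nat[OF prime_q] by simp_all

lemma p_pos [simp]: "p > 0" and q_pos [simp]: "q > 0"
  using p_gt_1 q_gt_1 by simp_all

text \<open>The exponent by which \<open>b\<^sup>t\<close> acts on \<open>c\<close> and \<open>d\<close>. Reducing \<open>t\<close> first makes \<open>R\<close> a homomorphism
  on all of \<open>\<int>\<close>, negative \<open>t\<close> included.\<close>

definition R :: "int \<Rightarrow> int" where
  "R t = r ^ nat (t mod int q) mod int p"

lemma R_mod [simp]: "R (t mod int q) = R t"
  by (simp add: R_def)

lemma R_of_nat: "R (int n) = r ^ n mod int p"
proof -
  have "[r ^ n = (r ^ q) ^ (n div q) * r ^ (n mod q)] (mod int p)"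
    by (simp flip: power_mult power_add)
  also have "[(r ^ q) ^ (n div q) * r ^ (n mod q) = 1 ^ (n div q) * r ^ (n mod q)] (mod int p)"
    by (intro cong_mult cong_pow r_pow_q cong_refl)
  finally show ?thesis by (simp add: R_def cong_def flip: zmod_int)
qed

lemma R_add: "R (s + t) = R s * R t mod int p"
proof -
  have "R (s + t) = R (int (nat (s mod int q) + nat (t mod int q)))"
    by (metis R_mod int_nat_eq mod_add_eq of_nat_add pos_mod_sign of_nat_0_less_iff q_pos)
  also have "\<dots> = R s * R t mod int p"
    unfolding R_of_nat by (simp add: R_def power_add mod_mult_eq)
  finally show ?thesis .
qed

lemma R_0 [simp]: "R 0 = 1"
  using p_gt_1 by (simp add: R_def)

lemma R_1: "R 1 = r mod int p"
  using R_of_nat[of 1] by simp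

lemma R_mod_p [simp]: "R t mod int p = R t"
  by (simp add: R_def)

text \<open>The order of \<open>r\<close> divides the prime \<open>q\<close> and is not \<open>1\<close>; a nontrivial \<open>t\<close> of trivial action could be
  inverted modulo \<open>q\<close>, which would force \<open>r \<equiv> 1\<close>.\<close>

lemma R_eq_1_iff: "R t = 1 \<longleftrightarrow> int q dvd t"
proof
  assume 1: "R t = 1"
  show "int q dvd t"
  proof (rule ccontr)
    assume "\<not> int q dvd t"
    then have "coprime t (int q)"
      using prime_q by (metis coprime_commute prime_imp_coprime prime_nat_int_transfer)
    then obtain n where n: "[t * n = 1] (mod int q)" using cong_solve_coprime_int by blast
    have "R (t * int m) = 1" for m
      using p_gt_1 by (induction m) (simp_all add: R_add 1 algebra_simps)
    moreover have "[t * int (nat (n mod int q)) = 1] (mod int q)"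
      using n by (simp add: cong_def mod_mult_right_eq)
    ultimately have "R 1 = 1" by (metis R_mod cong_def)
    then show False using r_neq_1 p_gt_1 by (simp add: R_1 cong_def)
  qed
next
  assume "int q dvd t"
  then show "R t = 1" using R_mod[of t] by (simp del: R_mod)
qed

text \<open>The tuple \<open>(s, t, x, y)\<close> stands for \<open>a\<^sup>s b\<^sup>t c\<^sup>x d\<^sup>y\<close>; collecting a product moves the second power of
  \<open>b\<close> to the left past the first powers of \<open>c\<close> and \<open>d\<close>, which multiplies their exponents by \<open>R t'\<close>.\<close>

definition K :: "(int \<times> int \<times> int \<times> int) monoid" where
  "K = \<lparr>carrier = {0..<int q} \<times> {0..<int q} \<times> {0..<int p} \<times> {0..<int p},
        mult = (\<lambda>(s, t, x, y) (s', t', x', y').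
          ((s + s') mod int q, (t + t') mod int q, (x * R t' + x') mod int p, (y * R t' + y') mod int p)),
        one = (0, 0, 0, 0)\<rparr>"

lemma mem_K: "(s, t, x, y) \<in> carrier K \<longleftrightarrow>
    s \<in> {0..<int q} \<and> t \<in> {0..<int q} \<and> x \<in> {0..<int p} \<and> y \<in> {0..<int p}"
  by (simp add: K_def)

lemma mult_K [simp]: "(s, t, x, y) \<otimes>\<^bsub>K\<^esub> (s', t', x', y') =
    ((s + s') mod int q, (t + t') mod int q, (x * R t' + x') mod int p, (y * R t' + y') mod int p)"
  by (simp add: K_def)

lemma one_K: "\<one>\<^bsub>K\<^esub> = (0, 0, 0, 0)"
  by (simp add: K_def)

lemma R_cancel: "(- x * R (- t)) mod int p * R t mod int p = - x mod int p"
proof -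
  have "(- x * R (- t)) mod int p * R t mod int p = - x * (R (- t) * R t mod int p) mod int p"
    by (rule mod_eqI, simp only: expand_mod) (auto simp: algebra_simps intro!: dvd_add dvd_diff)
  also have "R (- t) * R t mod int p = 1" using R_add[of "- t" t] by simp
  finally show ?thesis by simp
qed

sublocale K: group K
proof (rule groupI)
  fix g assume g: "g \<in> carrier K"
  obtain s t x y where g_eq: "g = (s, t, x, y)" by (cases g) auto
  have "((- x * R (- t)) mod int p * R t + x) mod int p = 0" for x
    using R_cancel[of x t] by (metis add.left_inverse mod_0 mod_add_left_eq)
  then have "(- s mod int q, - t mod int q, (- x * R (- t)) mod int p, (- y * R (- t)) mod int p) \<otimes>\<^bsub>K\<^esub> g = \<one>\<^bsub>K\<^esub>"
    by (simp add: g_eq one_K mod_simps)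
  moreover have "(- s mod int q, - t mod int q, (- x * R (- t)) mod int p, (- y * R (- t)) mod int p) \<in> carrier K"
    by (simp add: mem_K)
  ultimately show "\<exists>h\<in>carrier K. h \<otimes>\<^bsub>K\<^esub> g = \<one>\<^bsub>K\<^esub>" by blast
next
  fix g h k assume "g \<in> carrier K" "h \<in> carrier K" "k \<in> carrier K"
  obtain s t x y s' t' x' y' s'' t'' x'' y'' where
    ghk: "g = (s, t, x, y)" "h = (s', t', x', y')" "k = (s'', t'', x'', y'')"
    by (cases g, cases h, cases k) auto
  have "((x * R t' + x') mod int p * R t'' + x'') mod int p =
      (x * (R t' * R t'' mod int p) + (x' * R t'' + x'') mod int p) mod int p" for x x' x''
    by (rule mod_eqI, simp only: expand_mod) (auto simp: algebra_simps intro!: dvd_add dvd_diff)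
  then show "g \<otimes>\<^bsub>K\<^esub> h \<otimes>\<^bsub>K\<^esub> k = g \<otimes>\<^bsub>K\<^esub> (h \<otimes>\<^bsub>K\<^esub> k)"
    by (simp add: ghk R_add mod_simps add.assoc)
qed (auto simp: mem_K one_K)

abbreviation "gA \<equiv> (1, 0, 0, 0) :: int \<times> int \<times> int \<times> int"
abbreviation "gB \<equiv> (0, 1, 0, 0) :: int \<times> int \<times> int \<times> int"
abbreviation "gC \<equiv> (0, 0, 1, 0) :: int \<times> int \<times> int \<times> int"
abbreviation "gD \<equiv> (0, 0, 0, 1) :: int \<times> int \<times> int \<times> int"

lemma gens_in_K [simp]: "gA \<in> carrier K" "gB \<in> carrier K" "gC \<in> carrier K" "gD \<in> carrier K"
  using p_gt_1 q_gt_1 by (simp_all add: mem_K)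

lemma pow_top_K: "\<exists>x' y'. (s, t, x, y) [^]\<^bsub>K\<^esub> n = (int n * s mod int q, int n * t mod int q, x', y')"
  by (induction n) (auto simp: one_K mod_simps algebra_simps)

lemma pow_A: "(s, 0, 0, 0) [^]\<^bsub>K\<^esub> n = (int n * s mod int q, 0, 0, 0)"
  by (induction n) (auto simp: one_K mod_simps algebra_simps)

lemma pow_B: "(0, t, 0, 0) [^]\<^bsub>K\<^esub> n = (0, int n * t mod int q, 0, 0)"
  by (induction n) (auto simp: one_K mod_simps algebra_simps)

lemma pow_N: "(0, 0, x, y) [^]\<^bsub>K\<^esub> n = (0, 0, int n * x mod int p, int n * y mod int p)"
  by (induction n) (auto simp: one_K mod_simps algebra_simps)

lemma inv_N: "(0, 0, x, y) \<in> carrier K \<Longrightarrow> inv\<^bsub>K\<^esub> (0, 0, x, y) = (0, 0, - x mod int p, - y mod int p)"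
  by (rule K.inv_equality) (auto simp: mem_K one_K mod_simps)

lemma int_pow_N:
  assumes "(0, 0, x, y) \<in> carrier K"
  shows "(0, 0, x, y) [^]\<^bsub>K\<^esub> (k :: int) = (0, 0, k * x mod int p, k * y mod int p)"
proof (cases k rule: int_cases2)
  case (nonneg n)
  then show ?thesis by (simp add: int_pow_int pow_N)
next
  case (nonpos n)
  have "(0, 0, int n * x mod int p, int n * y mod int p) \<in> carrier K" by (simp add: mem_K)
  from inv_N[OF this] show ?thesis
    using assms by (simp add: nonpos K.int_pow_neg_int pow_N mod_simps)
qed

lemma normal_form_K:
  assumes "(s, t, x, y) \<in> carrier K"
  shows "(s, t, x, y) = gA [^]\<^bsub>K\<^esub> nat s \<otimes>\<^bsub>K\<^esub> gB [^]\<^bsub>K\<^esub> nat t \<otimes>\<^bsub>K\<^esub> (gC [^]\<^bsub>K\<^esub> nat x \<otimes>\<^bsub>K\<^esub> gD [^]\<^bsub>K\<^esub> nat y)"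
  using assms by (simp add: mem_K pow_A pow_B pow_N)

lemma hom_K_eqI:
  assumes "group H" "f \<in> hom K H" "f' \<in> hom K H"
    and "f gA = f' gA" "f gB = f' gB" "f gC = f' gC" "f gD = f' gD"
    and "k \<in> carrier K"
  shows "f k = f' k"
proof -
  obtain s t x y where k: "k = (s, t, x, y)" by (cases k) auto
  interpret f: group_hom K H f using assms K.is_group by (simp add: group_hom_def group_hom_axioms_def)
  interpret f': group_hom K H f' using assms K.is_group by (simp add: group_hom_def group_hom_axioms_def)
  show ?thesis
    using assms(8) unfolding k
    by (subst (1 2) normal_form_K)
       (simp_all del: mult_K add: f.hom_nat_pow f'.hom_nat_pow assms(4-7) K.nat_pow_closed)
qed

end

section \<open>The presented group is the concrete model\<close>

context group
begin

text \<open>Conjugation by \<open>b\<close> is a homomorphism and hence respects powers. The case \<open>e = c\<close> says that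
  everything commuting with \<open>c\<close> commutes with its powers.\<close>

lemma intertwine_int_pow:
  assumes "b \<in> carrier G" "c \<in> carrier G" "e \<in> carrier G" and eq: "c \<otimes> b = b \<otimes> e"
  shows "c [^] k \<otimes> b = b \<otimes> e [^] (k :: int)"
proof -
  have "b \<otimes> (inv b \<otimes> z) = z" if "z \<in> carrier G" for z
    using assms(1) that by (simp flip: m_assoc)
  then have "(\<lambda>x. inv b \<otimes> x \<otimes> b) \<in> hom G G"
    using assms(1) by (auto intro!: homI simp: m_assoc)
  then interpret conj: group_hom G G "\<lambda>x. inv b \<otimes> x \<otimes> b" by unfold_locales
  have "inv b \<otimes> c \<otimes> b = e"
    using assms by (simp add: m_assoc inv_solve_left')
  then have "inv b \<otimes> c [^] k \<otimes> b = e [^] k"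
    using conj.hom_int_pow[OF assms(2), of k] by simp
  then show ?thesis
    using assms by (simp add: m_assoc inv_solve_left')
qed

lemma int_pow_mod:
  assumes "a \<in> carrier G" "a [^] m = \<one>"
  shows "a [^] (k mod m :: int) = a [^] k"
proof -
  have "a [^] k = a [^] (m * (k div m) + k mod m)" by simp
  also have "\<dots> = (a [^] m) [^] (k div m) \<otimes> a [^] (k mod m)"
    using assms(1) by (simp only: int_pow_mult int_pow_pow)
  also have "\<dots> = a [^] (k mod m)"
    using assms by simp
  finally show ?thesis by (rule HOL.sym)
qed

lemma commutator_eq_one:
  assumes "x \<in> carrier G" "y \<in> carrier G" "x \<otimes> y = y \<otimes> x"
  shows "inv x \<otimes> inv y \<otimes> x \<otimes> y = \<one>"
proof -
  have "inv x \<otimes> inv y \<otimes> x \<otimes> y = inv (y \<otimes> x) \<otimes> (x \<otimes> y)"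
    using assms(1,2) by (simp add: inv_mult_group m_assoc)
  then show ?thesis using assms by simp
qed

lemma commutator_eq_oneD:
  assumes "x \<in> carrier G" "y \<in> carrier G" "inv x \<otimes> inv y \<otimes> x \<otimes> y = \<one>"
  shows "x \<otimes> y = y \<otimes> x"
proof -
  have "inv (y \<otimes> x) \<otimes> (x \<otimes> y) = \<one>"
    using assms by (simp add: inv_mult_group m_assoc)
  then show ?thesis
    using assms(1,2) inv_solve_left'[of "\<one>" "y \<otimes> x" "x \<otimes> y"] by simp
qed

end

context scalar_ext
begin

definition gen_K :: "gen \<Rightarrow> int \<times> int \<times> int \<times> int" where
  "gen_K x = (case x of GenA \<Rightarrow> gA | GenB \<Rightarrow> gB | GenC \<Rightarrow> gC | GenD \<Rightarrow> gD)"

lemma gen_K_simps [simp]: "gen_K GenA = gA" "gen_K GenB = gB" "gen_K GenC = gC" "gen_K GenD = gD"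
  by (simp_all add: gen_K_def)

lemma gen_K_closed [simp]: "gen_K x \<in> carrier K"
  by (cases x) (simp_all add: gen_K_def)

lemma eval_gen_word [simp]: "eval_word K gen_K (gen_word x) = gen_K x"
  using K.r_one[OF gen_K_closed, of x]
  by (simp add: gen_word_def K.eval_word_simps[OF gen_K_closed])

lemmas eval_K =
  K.eval_word_append[OF gen_K_closed] K.eval_word_inv[OF gen_K_closed]
  K.eval_word_pow[OF gen_K_closed] K.eval_word_comm[OF gen_K_closed]
  K.eval_word_simps(1)[OF gen_K_closed]

lemma relations_hold_in_K:
  assumes "(u, v) \<in> relations_G p q r"
  shows "eval_word K gen_K u = eval_word K gen_K v"
proof -
  have pow: "gA [^]\<^bsub>K\<^esub> int q = \<one>\<^bsub>K\<^esub>" "gB [^]\<^bsub>K\<^esub> int q = \<one>\<^bsub>K\<^esub>"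
    "gC [^]\<^bsub>K\<^esub> int p = \<one>\<^bsub>K\<^esub>" "gD [^]\<^bsub>K\<^esub> int p = \<one>\<^bsub>K\<^esub>"
    by (simp_all add: int_pow_int pow_A pow_B pow_N one_K)
  have conj: "inv\<^bsub>K\<^esub> gB \<otimes>\<^bsub>K\<^esub> (g \<otimes>\<^bsub>K\<^esub> gB) = g [^]\<^bsub>K\<^esub> r"
    if g: "g = (0, 0, x, y)" "g \<in> carrier K" for g x y
  proof -
    have "g \<otimes>\<^bsub>K\<^esub> gB = gB \<otimes>\<^bsub>K\<^esub> g [^]\<^bsub>K\<^esub> r"
      using that(2) p_gt_1 by (simp add: g(1) int_pow_N R_1 mod_simps mult.commute)
    then show ?thesis
      using that(2) by (simp add: K.inv_solve_left' del: mult_K)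
  qed
  have comm: "inv\<^bsub>K\<^esub> g \<otimes>\<^bsub>K\<^esub> inv\<^bsub>K\<^esub> h \<otimes>\<^bsub>K\<^esub> g \<otimes>\<^bsub>K\<^esub> h = \<one>\<^bsub>K\<^esub>"
    if "g \<in> carrier K" "h \<in> carrier K" "g \<otimes>\<^bsub>K\<^esub> h = h \<otimes>\<^bsub>K\<^esub> g" for g h
    using that by (rule K.commutator_eq_one)
  have commute: "gA \<otimes>\<^bsub>K\<^esub> gC = gC \<otimes>\<^bsub>K\<^esub> gA" "gA \<otimes>\<^bsub>K\<^esub> gD = gD \<otimes>\<^bsub>K\<^esub> gA"
    "gA \<otimes>\<^bsub>K\<^esub> gB = gB \<otimes>\<^bsub>K\<^esub> gA" "gC \<otimes>\<^bsub>K\<^esub> gD = gD \<otimes>\<^bsub>K\<^esub> gC"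
    by (simp_all add: R_1)
  note c = comm[OF gens_in_K(1,3) commute(1)] comm[OF gens_in_K(1,4) commute(2)]
    comm[OF gens_in_K(1,2) commute(3)] comm[OF gens_in_K(3,4) commute(4)]
  show ?thesis
    using assms conj[OF HOL.refl gens_in_K(3)] conj[OF HOL.refl gens_in_K(4)] c pow
    by (auto simp: relations_G_def Let_def eval_K simp del: mult_K)
qed

lemma eval_word_K_surj:
  assumes "k \<in> carrier K"
  shows "\<exists>w. eval_word K gen_K w = k"
proof -
  obtain s t x y where k: "k = (s, t, x, y)" by (cases k) auto
  let ?pow = "\<lambda>x n. word_pow (gen_word x) (int (nat n))"
  have "eval_word K gen_K ((?pow GenA s @ ?pow GenB t) @ (?pow GenC x @ ?pow GenD y)) = (s, t, x, y)"
    using assms unfolding k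
    by (subst normal_form_K) (simp_all only: eval_K eval_gen_word gen_K_simps int_pow_int)
  then show ?thesis unfolding k by blast
qed

text \<open>The map \<open>nf\<close> reads a tuple as a product in the presented group. It turns multiplication by a
  letter in \<open>K\<close> into multiplication by the same letter in the presented group, which is all that the
  relations have to provide; induction on words then shows that a class is the normal form of its
  value.\<close>

lemma G_pres_iso_K: "\<exists>f. f \<in> iso (G_pres p q r) K"
proof -
  define P where "P = presented_group (relations_G p q r)"
  interpret P: group P unfolding P_def by (rule presented_group_is_group)
  define cl where "cl x = word_rel (relations_G p q r) `` {gen_word x}" for x
  have cl [simp]: "cl x \<in> carrier P" for x
    by (auto simp: cl_def P_def carrier_presented_group)
  have ev: "eval_word P cl w = word_rel (relations_G p q r) `` {w}" for w
    unfolding cl_def P_def by (rule eval_word_presented_group)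
  have cl_gen: "eval_word P cl (gen_word x) = cl x" for x
    by (simp add: ev cl_def)
  have "eval_word P cl u = eval_word P cl v" if "(u, v) \<in> relations_G p q r" for u v
    unfolding ev using word_equiv.rel[OF that, of "[]" "[]"] by (simp add: word_class_eqI)
  then have "\<forall>(u, v)\<in>relations_G p q r. eval_word P cl u = eval_word P cl v" by blast
  note rel = this[unfolded relations_G_def Let_def]
  let ?a = "cl GenA" and ?b = "cl GenB" and ?c = "cl GenC" and ?d = "cl GenD"
  note evP = P.eval_word_append[OF cl] P.eval_word_inv[OF cl] P.eval_word_pow[OF cl]
    P.eval_word_comm[OF cl] P.eval_word_simps(1)[OF cl] cl_gen
  have rels: "?a [^]\<^bsub>P\<^esub> int q = \<one>\<^bsub>P\<^esub>" "?b [^]\<^bsub>P\<^esub> int q = \<one>\<^bsub>P\<^esub>"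
    "?c [^]\<^bsub>P\<^esub> int p = \<one>\<^bsub>P\<^esub>" "?d [^]\<^bsub>P\<^esub> int p = \<one>\<^bsub>P\<^esub>"
    "?a \<otimes>\<^bsub>P\<^esub> ?c = ?c \<otimes>\<^bsub>P\<^esub> ?a" "?a \<otimes>\<^bsub>P\<^esub> ?d = ?d \<otimes>\<^bsub>P\<^esub> ?a"
    "?a \<otimes>\<^bsub>P\<^esub> ?b = ?b \<otimes>\<^bsub>P\<^esub> ?a" "?c \<otimes>\<^bsub>P\<^esub> ?d = ?d \<otimes>\<^bsub>P\<^esub> ?c"
    "inv\<^bsub>P\<^esub> ?b \<otimes>\<^bsub>P\<^esub> (?c \<otimes>\<^bsub>P\<^esub> ?b) = ?c [^]\<^bsub>P\<^esub> r"
    "inv\<^bsub>P\<^esub> ?b \<otimes>\<^bsub>P\<^esub> (?d \<otimes>\<^bsub>P\<^esub> ?b) = ?d [^]\<^bsub>P\<^esub> r"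
    using rel by (simp_all add: evP P.m_assoc)
      (intro P.commutator_eq_oneD; simp add: P.m_assoc)+
  have cb: "?c \<otimes>\<^bsub>P\<^esub> ?b = ?b \<otimes>\<^bsub>P\<^esub> ?c [^]\<^bsub>P\<^esub> r" "?d \<otimes>\<^bsub>P\<^esub> ?b = ?b \<otimes>\<^bsub>P\<^esub> ?d [^]\<^bsub>P\<^esub> r"
    using rels(9,10) by (simp_all add: P.inv_solve_left')
  define nf :: "int \<times> int \<times> int \<times> int \<Rightarrow> gen word set" where
    "nf = (\<lambda>(s, t, x, y). ?a [^]\<^bsub>P\<^esub> s \<otimes>\<^bsub>P\<^esub> ?b [^]\<^bsub>P\<^esub> t \<otimes>\<^bsub>P\<^esub>
      (?c [^]\<^bsub>P\<^esub> x \<otimes>\<^bsub>P\<^esub> ?d [^]\<^bsub>P\<^esub> y))"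
  have nf_closed [simp]: "nf k \<in> carrier P" for k
    by (cases k) (auto simp: nf_def)
  have nf_gen: "nf (k \<otimes>\<^bsub>K\<^esub> gen_K z) = nf k \<otimes>\<^bsub>P\<^esub> cl z" for k z
  proof -
    obtain s t x y where k: "k = (s, t, x, y)" by (cases k) auto
    note tw = P.intertwine_int_pow[OF cl cl]
    note mod = rels(1-4)[THEN P.int_pow_mod[OF cl]]
    have c_r: "?c [^]\<^bsub>P\<^esub> x \<otimes>\<^bsub>P\<^esub> ?b = ?b \<otimes>\<^bsub>P\<^esub> ?c [^]\<^bsub>P\<^esub> (r * x)"
      "?d [^]\<^bsub>P\<^esub> y \<otimes>\<^bsub>P\<^esub> ?b = ?b \<otimes>\<^bsub>P\<^esub> ?d [^]\<^bsub>P\<^esub> (r * y)"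
      using tw[OF _ cb(1)] tw[OF _ cb(2)] by (simp_all add: P.int_pow_pow)
    have R1: "?c [^]\<^bsub>P\<^esub> (x * R 1) = ?c [^]\<^bsub>P\<^esub> (r * x)"
      "?d [^]\<^bsub>P\<^esub> (y * R 1) = ?d [^]\<^bsub>P\<^esub> (r * y)"
      using mod(3)[of "x * R 1"] mod(3)[of "r * x"] mod(4)[of "y * R 1"] mod(4)[of "r * y"]
      by (simp_all add: R_1 mod_simps mult.commute)
    have aa: "?b [^]\<^bsub>P\<^esub> t \<otimes>\<^bsub>P\<^esub> ?a = ?a \<otimes>\<^bsub>P\<^esub> ?b [^]\<^bsub>P\<^esub> t"
       "?c [^]\<^bsub>P\<^esub> x \<otimes>\<^bsub>P\<^esub> ?a = ?a \<otimes>\<^bsub>P\<^esub> ?c [^]\<^bsub>P\<^esub> x"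
       "?d [^]\<^bsub>P\<^esub> y \<otimes>\<^bsub>P\<^esub> ?a = ?a \<otimes>\<^bsub>P\<^esub> ?d [^]\<^bsub>P\<^esub> y"
       "?d [^]\<^bsub>P\<^esub> y \<otimes>\<^bsub>P\<^esub> ?c = ?c \<otimes>\<^bsub>P\<^esub> ?d [^]\<^bsub>P\<^esub> y"
      using tw[OF cl rels(5)[symmetric]] tw[OF cl rels(6)[symmetric]] tw[OF cl rels(7)[symmetric]]
        tw[OF cl rels(8)[symmetric]] by simp_all
    have push: "u \<otimes>\<^bsub>P\<^esub> (v \<otimes>\<^bsub>P\<^esub> z) = v' \<otimes>\<^bsub>P\<^esub> (u' \<otimes>\<^bsub>P\<^esub> z)"
      if "u \<otimes>\<^bsub>P\<^esub> v = v' \<otimes>\<^bsub>P\<^esub> u'" "u \<in> carrier P" "v \<in> carrier P" "u' \<in> carrier P" "v' \<in> carrier P" "z \<in> carrier P"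
      for u v u' v' z using that by (simp flip: P.m_assoc)
    show ?thesis
      by (cases z) (simp_all add: k nf_def mod P.int_pow_mult P.m_assoc R1 c_r aa c_r[THEN push] aa[THEN push])
  qed
  have nf_letter: "nf (k \<otimes>\<^bsub>K\<^esub> (if s then gen_K z else inv\<^bsub>K\<^esub> (gen_K z)))
      = nf k \<otimes>\<^bsub>P\<^esub> (if s then cl z else inv\<^bsub>P\<^esub> (cl z))"
    if k: "k \<in> carrier K" for k z s
    \<comment> \<open>For an inverse letter, apply \<open>nf_gen\<close> to \<open>k\<close> times that letter and cancel.\<close>
  proof (cases s)
    case True
    then show ?thesis using nf_gen by simp
  next
    case False
    have "nf (k \<otimes>\<^bsub>K\<^esub> inv\<^bsub>K\<^esub> (gen_K z)) \<otimes>\<^bsub>P\<^esub> cl z = nf k"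
      using k nf_gen[of "k \<otimes>\<^bsub>K\<^esub> inv\<^bsub>K\<^esub> (gen_K z)" z] by (simp add: K.m_assoc)
    then have "nf (k \<otimes>\<^bsub>K\<^esub> inv\<^bsub>K\<^esub> (gen_K z)) = nf k \<otimes>\<^bsub>P\<^esub> inv\<^bsub>P\<^esub> (cl z)"
      by (simp add: P.inv_solve_right)
    then show ?thesis using False by simp
  qed
  have "nf (eval_word K gen_K w) = eval_word P cl w" for w
  proof (induction w rule: rev_induct)
    case Nil
    show ?case by (simp add: eval_K P.eval_word_simps(1)[OF cl] nf_def one_K)
  next
    case (snoc l w)
    obtain z s where "l = (z, s)" by force
    then show ?case
      using nf_letter[of "eval_word K gen_K w" s z, OF K.eval_word_closed[OF gen_K_closed]] snoc
      by (simp add: K.eval_word_append[OF gen_K_closed] K.eval_word_simps[OF gen_K_closed]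
            P.eval_word_append[OF cl] P.eval_word_simps[OF cl] K.r_one P.r_one)
  qed
  then show ?thesis
    unfolding G_pres_def ev
    by (intro iso_presented_groupI[OF K.is_group gen_K_closed relations_hold_in_K eval_word_K_surj])
qed

end

section \<open>Residue matrices and the multiplicative group modulo a prime\<close>

lemma mult_mat_mod_monoid_2:
  assumes "A \<in> carrier_mat 2 2" "B \<in> carrier_mat 2 2" "a < 2" "b < 2"
  shows "(A \<otimes>\<^bsub>mat_mod_monoid 2 m\<^esub> B) $$ (a, b) =
    (A $$ (a, 0) * B $$ (0, b) + A $$ (a, 1) * B $$ (1, b)) mod int m"
  using assms by (simp add: mat_mod_monoid_def scalar_prod_def numeral_2_eq_2)

lemma carrier_mat_mod_monoid: "A \<in> carrier (mat_mod_monoid n m) \<Longrightarrow> A \<in> carrier_mat n n"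
  by (simp add: mat_mod_monoid_def)

lemma one_mat_mod_monoid_2:
  "a < 2 \<Longrightarrow> b < 2 \<Longrightarrow> m > 1 \<Longrightarrow> \<one>\<^bsub>mat_mod_monoid 2 m\<^esub> $$ (a, b) = (if a = b then 1 else 0)"
  by (simp add: mat_mod_monoid_def)

lemma mat_mod_2_eqI:
  assumes "A \<in> carrier (mat_mod_monoid 2 m)" "B \<in> carrier (mat_mod_monoid 2 m)"
    and "A $$ (0, 0) = B $$ (0, 0)" "A $$ (0, 1) = B $$ (0, 1)"
      "A $$ (1, 0) = B $$ (1, 0)" "A $$ (1, 1) = B $$ (1, 1)"
  shows "A = B"
  using assms by (intro eq_matI) (auto simp: mat_mod_monoid_def less_2_cases_iff)

lemma entry_mod:
  assumes "A \<in> carrier (mat_mod_monoid 2 m)" "a < 2" "b < 2"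
  shows "A $$ (a, b) mod int m = A $$ (a, b)"
  using assms by (auto simp: mat_mod_monoid_def)

text \<open>A discrete exponential function: powers of a primitive root identify the additive group modulo
  \<open>q - 1\<close> with the multiplicative group modulo \<open>q\<close>. For \<open>q = 2\<close> both are trivial.\<close>

lemma prime_exp_mod:
  assumes "prime q"
  obtains e :: "int \<Rightarrow> int" where
    "\<forall>k. e k \<in> {0..<int q}" "e 0 = 1"
    "\<forall>k\<ge>0. \<forall>l\<ge>0. e ((k + l) mod int (q - 1)) = e k * e l mod int q"
    "inj_on e {0..<int (q - 1)}"
    "\<forall>i\<in>{1..<int q}. \<exists>k\<in>{0..<int (q - 1)}. e k = i"
proof -
  have q: "q > 1" using assms by (rule prime_gt_1_nat)
  obtain g where g: "residue_primroot q g"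
    using prime_primitive_root_exists[of q] assms q by auto
  have bij: "bij_betw (\<lambda>i. g ^ i mod q) {..<q - 1} (totatives q)"
    using residue_primroot_is_generator[OF q g] by (simp add: totient_prime assms)
  have cop: "coprime q g" using g by (simp add: residue_primroot_def)
  define e :: "int \<Rightarrow> int" where "e k = int (g ^ nat k mod q)" for k
  have red: "g ^ (n mod (q - 1)) mod q = g ^ n mod q" for n
  proof -
    have "[g ^ (q - 1) = 1] (mod q)"
      using fermat_theorem[OF assms] cop prime_gt_1_nat[OF assms]
      by (metis coprime_absorb_left not_prime_unit assms)
    then have "[(g ^ (q - 1)) ^ (n div (q - 1)) * g ^ (n mod (q - 1)) = 1 ^ (n div (q - 1)) * g ^ (n mod (q - 1))] (mod q)"
      by (intro cong_mult cong_pow cong_refl)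
    then show ?thesis by (simp add: cong_def flip: power_mult power_add)
  qed
  show thesis
  proof (rule that[of e])
    show "\<forall>k. e k \<in> {0..<int q}" using q by (simp add: e_def)
    show "e 0 = 1" using q by (simp add: e_def)
    show "\<forall>k\<ge>0. \<forall>l\<ge>0. e ((k + l) mod int (q - 1)) = e k * e l mod int q"
    proof (intro allI impI)
      fix k l :: int assume that: "0 \<le> k" "0 \<le> l"
      have "nat ((k + l) mod int (q - 1)) = (nat k + nat l) mod (q - 1)"
        using that by (simp add: nat_mod_distrib nat_add_distrib)
      then have "g ^ nat ((k + l) mod int (q - 1)) mod q = g ^ nat k * g ^ nat l mod q"
        by (simp add: red[simplified] power_add)
      then show "e ((k + l) mod int (q - 1)) = e k * e l mod int q"
        unfolding e_def by (simp only: flip: of_nat_mult zmod_int) (simp add: mod_mult_eq)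
    qed
    show "inj_on e {0..<int (q - 1)}"
    proof (rule inj_onI)
      fix k l assume kl: "k \<in> {0..<int (q - 1)}" "l \<in> {0..<int (q - 1)}" "e k = e l"
      have "g ^ nat k mod q = g ^ nat l mod q"
        using kl(3) unfolding e_def by (simp only: of_nat_eq_iff)
      moreover have "nat k < q - 1" "nat l < q - 1" using kl(1,2) by auto
      ultimately have "nat k = nat l"
        using inj_onD[OF bij_betw_imp_inj_on[OF bij], of "nat k" "nat l"] by blast
      then show "k = l" using kl by auto
    qed
    show "\<forall>i\<in>{1..<int q}. \<exists>k\<in>{0..<int (q - 1)}. e k = i"
    proof
      fix i assume that: "i \<in> {1..<int q}"
      have "nat i \<in> totatives q"
        using that assms by (auto simp: totatives_prime nat_less_iff)
      then have "nat i \<in> (\<lambda>i. g ^ i mod q) ` {..<q - 1}"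
        by (simp only: bij_betw_imp_surj_on[OF bij])
      then obtain n where "n < q - 1" "g ^ n mod q = nat i" by auto
      then have "int n \<in> {0..<int (q - 1)} \<and> e (int n) = i" using that by (simp add: e_def)
      then show "\<exists>k\<in>{0..<int (q - 1)}. e k = i" by blast
    qed
  qed
qed

section \<open>The automorphisms of the model\<close>

context scalar_ext
begin

text \<open>The automorphism with \<open>a \<mapsto> a\<^sup>i\<close> and \<open>b \<mapsto> a\<^sup>j b\<close> that acts on the plane by \<open>M\<close>, followed by
  \<open>k \<mapsto> n\<^sup>-\<^sup>1 k n\<close> for \<open>n = c\<^sup>u d\<^sup>v\<close>: this conjugation contributes the terms with \<open>1 - R t\<close>. Invertibility
  of \<open>i\<close> and \<open>M\<close> is not built in, since it comes out of the composition law.\<close>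

definition act :: "int \<Rightarrow> int \<Rightarrow> int mat \<Rightarrow> int \<Rightarrow> int \<Rightarrow> int \<times> int \<times> int \<times> int \<Rightarrow> int \<times> int \<times> int \<times> int"
  where "act i j M u v = (\<lambda>(s, t, x, y)\<in>carrier K.
    ((i * s + j * t) mod int q, t,
     (M $$ (0, 0) * x + M $$ (0, 1) * y + (1 - R t) * u) mod int p,
     (M $$ (1, 0) * x + M $$ (1, 1) * y + (1 - R t) * v) mod int p))"

lemma act_apply:
  "(s, t, x, y) \<in> carrier K \<Longrightarrow> act i j M u v (s, t, x, y) =
    ((i * s + j * t) mod int q, t,
     (M $$ (0, 0) * x + M $$ (0, 1) * y + (1 - R t) * u) mod int p,
     (M $$ (1, 0) * x + M $$ (1, 1) * y + (1 - R t) * v) mod int p)"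
  by (simp add: act_def)

lemma act_closed: "k \<in> carrier K \<Longrightarrow> act i j M u v k \<in> carrier K"
  by (cases k) (auto simp: act_apply, auto simp: mem_K)

lemma act_hom: "act i j M u v \<in> hom K K"
proof (rule homI)
  fix g h assume g: "g \<in> carrier K" and h: "h \<in> carrier K"
  obtain s t x y s' t' x' y' where gh: "g = (s, t, x, y)" "h = (s', t', x', y')"
    by (cases g, cases h) auto
  have 1: "(i * ((s + s') mod int q) + j * ((t + t') mod int q)) mod int q =
      ((i * s + j * t) mod int q + (i * s' + j * t') mod int q) mod int q"
    by (rule mod_eqI, simp only: expand_mod) (auto simp: algebra_simps intro!: dvd_add dvd_diff)
  have 2: "(a * ((x * R t' + x') mod int p) + b * ((y * R t' + y') mod int p) + (1 - R t * R t' mod int p) * w) mod int p =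
      ((a * x + b * y + (1 - R t) * w) mod int p * R t' + (a * x' + b * y' + (1 - R t') * w) mod int p) mod int p"
    for a b w
    by (rule mod_eqI, simp only: expand_mod) (auto simp: algebra_simps intro!: dvd_add dvd_diff)
  show "act i j M u v (g \<otimes>\<^bsub>K\<^esub> h) = act i j M u v g \<otimes>\<^bsub>K\<^esub> act i j M u v h"
    using g h K.m_closed[OF g h] by (simp add: gh act_apply 1 2 R_add)
qed (rule act_closed)

text \<open>The composition law. The translation part of the composite is \<open>w + M w'\<close>, with no trace of \<open>r\<close>;
  this is the gain from parametrizing by \<open>w\<close> rather than by the value at \<open>b\<close>.\<close>

lemma act_act:
  assumes M: "M \<in> carrier_mat 2 2" "M' \<in> carrier_mat 2 2" and k: "k \<in> carrier K"
  shows "act i j M u v (act i' j' M' u' v' k) =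
    act (i * i' mod int q) ((j + i * j') mod int q) (M \<otimes>\<^bsub>mat_mod_monoid 2 p\<^esub> M')
      ((u + (M $$ (0, 0) * u' + M $$ (0, 1) * v') mod int p) mod int p)
      ((v + (M $$ (1, 0) * u' + M $$ (1, 1) * v') mod int p) mod int p) k"
proof -
  obtain s t x y where k_eq: "k = (s, t, x, y)" by (cases k) auto
  have 1: "(i * ((i' * s + j' * t) mod int q) + j * t) mod int q =
      (i * i' mod int q * s + (j + i * j') mod int q * t) mod int q"
    by (rule mod_eqI, simp only: expand_mod) (auto simp: algebra_simps intro!: dvd_add dvd_diff)
  have 2: "(a * ((a' * x + b' * y + (1 - R t) * u') mod int p) + b * ((c' * x + d' * y + (1 - R t) * v') mod int p)
        + (1 - R t) * w) mod int p =
      ((a * a' + b * c') mod int p * x + (a * b' + b * d') mod int p * y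
        + (1 - R t) * ((w + (a * u' + b * v') mod int p) mod int p)) mod int p"
    for a b a' b' c' d' w
    by (rule mod_eqI, simp only: expand_mod) (auto simp: algebra_simps intro!: dvd_add dvd_diff)
  show ?thesis
    using k act_closed[OF k, of i' j' M' u' v']
    by (simp add: k_eq act_apply 1 2 mult_mat_mod_monoid_2[OF M])
qed

lemma act_one: "k \<in> carrier K \<Longrightarrow> act 1 0 \<one>\<^bsub>mat_mod_monoid 2 p\<^esub> 0 0 k = k"
  using p_gt_1 by (cases k) (auto simp: act_apply one_mat_mod_monoid_2, auto simp: mem_K)

text \<open>This makes every element of the plane a value \<open>(1 - r) w\<close> for exactly one \<open>w\<close>.\<close>

lemma coprime_one_minus_r: "coprime (1 - R 1) (int p)"
proof -
  have "\<not> int p dvd 1 - R 1"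
    using r_neq_1 by (metis R_1 R_mod_p cong_iff_dvd_diff cong_mod_right cong_sym)
  then show ?thesis
    using prime_p by (metis coprime_commute prime_imp_coprime prime_nat_int_transfer)
qed

text \<open>The values at the four generators reveal all parameters.\<close>

lemma act_inject:
  assumes eq: "\<And>k. k \<in> carrier K \<Longrightarrow> act i j M u v k = act i' j' M' u' v' k"
    and M: "M \<in> carrier (mat_mod_monoid 2 p)" "M' \<in> carrier (mat_mod_monoid 2 p)"
    and ij: "i \<in> {0..<int q}" "i' \<in> {0..<int q}" "j \<in> {0..<int q}" "j' \<in> {0..<int q}"
    and uv: "u \<in> {0..<int p}" "u' \<in> {0..<int p}" "v \<in> {0..<int p}" "v' \<in> {0..<int p}"
  shows "i = i' \<and> j = j' \<and> M = M' \<and> u = u' \<and> v = v'"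
proof -
  have canc: "w = w'"
    if "(1 - R 1) * w mod int p = (1 - R 1) * w' mod int p" "w \<in> {0..<int p}" "w' \<in> {0..<int p}" for w w'
    using that cong_mult_lcancel[OF coprime_one_minus_r, of w w'] by (simp add: cong_def)
  have "M = M'"
    using eq[OF gens_in_K(3)] eq[OF gens_in_K(4)]
    by (intro mat_mod_2_eqI[OF M]) (simp_all add: act_apply entry_mod M)
  moreover have "i = i'" "j = j'"
    using eq[OF gens_in_K(1)] eq[OF gens_in_K(2)] ij by (simp_all add: act_apply)
  moreover have "(1 - R 1) * u mod int p = (1 - R 1) * u' mod int p"
    "(1 - R 1) * v mod int p = (1 - R 1) * v' mod int p"
    using eq[OF gens_in_K(2)] by (simp_all add: act_apply)
  then have "u = u'" "v = v'"
    using canc uv by blast+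
  ultimately show ?thesis by blast
qed

text \<open>The \<open>p\<close>-th power multiplies the exponents of \<open>a\<close> and \<open>b\<close> by \<open>p\<close>, which is invertible modulo \<open>q\<close>.
  Hence any automorphism preserves the plane.\<close>

lemma torsion_in_N:
  assumes k: "k \<in> carrier K" "k [^]\<^bsub>K\<^esub> p = \<one>\<^bsub>K\<^esub>"
  obtains x y where "k = (0, 0, x, y)"
proof -
  obtain s t x y where k_eq: "k = (s, t, x, y)" by (cases k) auto
  have cop: "coprime (int q) (int p)"
    using primes_coprime[OF prime_q prime_p] p_neq_q by simp
  have "int p * s mod int q = 0" "int p * t mod int q = 0"
    using pow_top_K[of s t x y p] k(2) by (auto simp: k_eq one_K)
  then have "int q dvd s" "int q dvd t"
    using cop by (simp_all add: coprime_dvd_mult_right_iff mod_eq_0_iff_dvd)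
  then have "s = 0" "t = 0"
    using k(1) by (auto simp: k_eq mem_K dest!: zdvd_imp_le)
  then show thesis using that k_eq by blast
qed

text \<open>Commuting with \<open>c\<close> excludes powers of \<open>b\<close>; commuting with \<open>b\<close> then leaves only the zero vector
  of the plane, as \<open>1 - r\<close> is invertible.\<close>

lemma center_K:
  assumes k: "k \<in> carrier K" and B: "k \<otimes>\<^bsub>K\<^esub> gB = gB \<otimes>\<^bsub>K\<^esub> k" and C: "k \<otimes>\<^bsub>K\<^esub> gC = gC \<otimes>\<^bsub>K\<^esub> k"
  obtains s where "k = (s, 0, 0, 0)"
proof -
  obtain s t x y where k_eq: "k = (s, t, x, y)" by (cases k) auto
  have "(x + 1) mod int p = (x + R t) mod int p"
    using C by (simp add: k_eq add.commute)
  then have "R t = 1"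
    using p_gt_1 by (metis R_mod_p cong_add_lcancel cong_def mod_pos_pos_trivial zero_le_one)
  then have t: "t = 0" using k by (auto simp: R_eq_1_iff k_eq mem_K dest!: zdvd_imp_le)
  have zero: "w = 0" if "w * R 1 mod int p = w mod int p" "w \<in> {0..<int p}" for w
  proof -
    have "int p dvd (1 - R 1) * w"
      using that(1) by (simp add: mod_eq_dvd_iff algebra_simps dvd_diff_commute)
    then have "int p dvd w"
      using coprime_one_minus_r by (simp add: coprime_dvd_mult_right_iff coprime_commute)
    then show ?thesis using that(2) by (auto dest!: zdvd_imp_le)
  qed
  have "x = 0" "y = 0" using B k by (auto intro!: zero simp: k_eq t mem_K)
  then show thesis using that k_eq t by blast
qed

text \<open>Since \<open>act\<close> is a homomorphism for all parameters, it suffices to match \<open>f\<close> on the four generators.\<close>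

lemma auto_is_act:
  assumes f: "f \<in> auto K"
  obtains i j M u v where "i \<in> {0..<int q}" "j \<in> {0..<int q}" "M \<in> carrier (mat_mod_monoid 2 p)"
    "u \<in> {0..<int p}" "v \<in> {0..<int p}" "f = act i j M u v"
proof -
  have hom: "f \<in> hom K K" and bij: "bij_betw f (carrier K) (carrier K)" and ext: "f \<in> extensional (carrier K)"
    using f by (simp_all add: auto_def Bij_def)
  interpret f: group_hom K K f using hom by unfold_locales
  have N: "\<exists>x y. f g = (0, 0, x, y)" if "g \<in> carrier K" "g [^]\<^bsub>K\<^esub> p = \<one>\<^bsub>K\<^esub>" for g
    using torsion_in_N[OF f.hom_closed[OF that(1)]] that f.hom_nat_pow[OF that(1), of p]
    by (metis f.hom_one)
  obtain a c where fC: "f gC = (0, 0, a, c)"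
    using N[OF gens_in_K(3)] by (auto simp: pow_N one_K)
  obtain b d where fD: "f gD = (0, 0, b, d)"
    using N[OF gens_in_K(4)] by (auto simp: pow_N one_K)
  have central: "f gA \<otimes>\<^bsub>K\<^esub> k = k \<otimes>\<^bsub>K\<^esub> f gA" if k: "k \<in> carrier K" for k
  proof -
    have "k \<in> f ` carrier K" using bij k by (simp add: bij_betw_def)
    then obtain h where h: "h \<in> carrier K" "k = f h" by blast
    have "gA \<otimes>\<^bsub>K\<^esub> h = h \<otimes>\<^bsub>K\<^esub> gA"
      using h(1) by (cases h) (simp add: mem_K add.commute)
    then show ?thesis
      using h gens_in_K(1) by (metis f.hom_mult)
  qed
  obtain i where fA: "f gA = (i, 0, 0, 0)"
    by (rule center_K[OF f.hom_closed[OF gens_in_K(1)] central[OF gens_in_K(2)] central[OF gens_in_K(3)]])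
  obtain j t x y where fB: "f gB = (j, t, x, y)" by (rule prod_cases4)
  have carr: "(i, 0, 0, 0) \<in> carrier K" "(j, t, x, y) \<in> carrier K" "(0, 0, a, c) \<in> carrier K" "(0, 0, b, d) \<in> carrier K"
    using f.hom_closed[OF gens_in_K(1)] f.hom_closed[OF gens_in_K(2)] f.hom_closed[OF gens_in_K(3)]
      f.hom_closed[OF gens_in_K(4)] by (simp_all only: fA fB fC fD)
  \<comment> \<open>Applying \<open>f\<close> to \<open>c b = b c\<^sup>r\<close> shows that \<open>f b\<close> acts on the nonzero vector \<open>f c\<close>, and so on the
    plane, by the scalar \<open>r\<close>; this forces \<open>t = 1\<close>.\<close>
  have "gC \<otimes>\<^bsub>K\<^esub> gB = gB \<otimes>\<^bsub>K\<^esub> gC [^]\<^bsub>K\<^esub> nat (R 1)"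
    by (simp add: pow_N R_def)
  then have "f gC \<otimes>\<^bsub>K\<^esub> f gB = f gB \<otimes>\<^bsub>K\<^esub> f gC [^]\<^bsub>K\<^esub> nat (R 1)"
    by (metis K.nat_pow_closed f.hom_mult f.hom_nat_pow gens_in_K(2,3))
  moreover have "R 1 \<ge> 0" by (simp add: R_def)
  ultimately have "(x + a * R t) mod int p = (x + a * R 1) mod int p" "(y + c * R t) mod int p = (y + c * R 1) mod int p"
    by (simp_all add: fB fC pow_N mod_simps algebra_simps)
  then have ac: "[a * R t = a * R 1] (mod int p)" "[c * R t = c * R 1] (mod int p)"
    unfolding cong_def[symmetric] by (simp_all only: cong_add_lcancel)
  have "f gC \<noteq> f \<one>\<^bsub>K\<^esub>"
    using bij gens_in_K(3) K.one_closed by (metis Pair_inject bij_betw_imp_inj_on inj_onD one_K zero_neq_one)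
  then have "a \<noteq> 0 \<or> c \<noteq> 0" using f.hom_one by (auto simp: fC one_K)
  moreover have "[R t = R 1] (mod int p)" if "[w * R t = w * R 1] (mod int p)" "w \<in> {0..<int p}" "w \<noteq> 0" for w
  proof -
    have "\<not> int p dvd w" using that(2,3) by (auto dest: zdvd_imp_le)
    then have "coprime w (int p)"
      using prime_p by (metis coprime_commute prime_imp_coprime prime_nat_int_transfer)
    then show ?thesis using that(1) cong_mult_lcancel by blast
  qed
  ultimately have "[R t = R 1] (mod int p)" using ac carr(3) by (auto simp: mem_K)
  then have "R t = R 1" by (simp add: cong_def)
  then have "R (t + - 1) = 1" using R_add[of t "- 1"] R_add[of 1 "- 1"] by simp
  then have "int q dvd t - 1" by (simp add: R_eq_1_iff)
  then have "t mod int q = 1 mod int q" by (simp add: mod_eq_dvd_iff)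
  then have t: "t = 1" using carr(2) q_gt_1 by (simp add: mem_K)
  have solve: "\<exists>u\<in>{0..<int p}. (1 - R 1) * u mod int p = z" if "z \<in> {0..<int p}" for z
  proof -
    obtain n where n: "[(1 - R 1) * n = 1] (mod int p)"
      using cong_solve_coprime_int[OF coprime_one_minus_r] by blast
    have "[(1 - R 1) * (n * z) = 1 * z] (mod int p)"
      unfolding mult.assoc[symmetric] by (intro cong_mult n cong_refl)
    then have "(1 - R 1) * (n * z mod int p) mod int p = z"
      using that by (simp add: cong_def mod_mult_right_eq)
    then show ?thesis by (intro bexI[of _ "n * z mod int p"]) simp_all
  qed
  obtain u v where uv: "u \<in> {0..<int p}" "(1 - R 1) * u mod int p = x" "v \<in> {0..<int p}" "(1 - R 1) * v mod int p = y"
    using solve[of x] solve[of y] carr(2) by (auto simp: mem_K)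
  define M where "M = mat 2 2 (\<lambda>(k, l). if l = 0 then if k = 0 then a else c else if k = 0 then b else d)"
  have M: "M \<in> carrier (mat_mod_monoid 2 p)"
    using carr(3,4) by (auto simp: M_def mat_mod_monoid_def mem_K)
  have M_entries: "M $$ (0, 0) = a" "M $$ (0, 1) = b" "M $$ (1, 0) = c" "M $$ (1, 1) = d"
    by (simp_all add: M_def)
  have "f k = act i j M u v k" if "k \<in> carrier K" for k
  proof (rule hom_K_eqI[OF K.is_group hom act_hom _ _ _ _ that])
    show "f gA = act i j M u v gA" "f gC = act i j M u v gC" "f gD = act i j M u v gD"
      using carr unfolding act_apply[OF gens_in_K(1)] act_apply[OF gens_in_K(3)] act_apply[OF gens_in_K(4)] M_entries
      by (simp_all add: fA fC fD mem_K)
    show "f gB = act i j M u v gB"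
      using carr(2) uv unfolding act_apply[OF gens_in_K(2)]
      by (simp add: fB t mem_K)
  qed
  then have "f = act i j M u v"
    using ext by (intro extensionalityI[of f "carrier K"]) (simp_all add: act_def)
  then show thesis
    using that[of i j M u v] carr(1,2) M uv by (auto simp: mem_K)
qed

end

section \<open>The automorphism group as a semidirect product\<close>

context scalar_ext
begin

abbreviation V :: "(int \<times> int) monoid" where
  "V \<equiv> integer_mod_group p \<times>\<times> integer_mod_group p"

lemma carrier_Zp [simp]: "carrier (integer_mod_group p) = {0..<int p}"
  using p_pos by (simp add: carrier_integer_mod_group)

lemma carrier_V: "carrier V = {0..<int p} \<times> {0..<int p}"
  by simp

lemma group_V: "group V"
  by (intro DirProd_group group_integer_mod_group)

lemma auto_K_inverse:
  assumes f: "f \<in> auto K"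
  obtains f' where "f' \<in> auto K" "\<forall>k\<in>carrier K. f (f' k) = k" "\<forall>k\<in>carrier K. f' (f k) = k"
proof -
  interpret Aut: group "AutoGroup K" by (rule K.AutoGroup)
  define f' where "f' = inv\<^bsub>AutoGroup K\<^esub> f"
  have fA: "f \<in> carrier (AutoGroup K)" using f by (simp add: AutoGroup_def)
  then have f': "f' \<in> auto K"
    unfolding f'_def using Aut.inv_closed by (simp add: AutoGroup_def)
  have one: "\<one>\<^bsub>AutoGroup K\<^esub> = (\<lambda>k\<in>carrier K. k)" by (simp add: AutoGroup_def BijGroup_def)
  have eqs: "compose (carrier K) f f' = (\<lambda>k\<in>carrier K. k)" "compose (carrier K) f' f = (\<lambda>k\<in>carrier K. k)"
    using Aut.r_inv[OF fA] Aut.l_inv[OF fA] mult_AutoGroup[OF f f'] mult_AutoGroup[OF f' f]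
    by (simp_all add: f'_def one)
  show thesis
  proof (rule that[OF f'])
    show "\<forall>k\<in>carrier K. f (f' k) = k" "\<forall>k\<in>carrier K. f' (f k) = k"
      using fun_cong[OF eqs(1)] fun_cong[OF eqs(2)] by (simp_all add: compose_def) metis+
  qed
qed

text \<open>Writing the inverse automorphism as an \<open>act\<close> too, the composition law and uniqueness of
  parameters show that \<open>M\<close> and \<open>i\<close> have inverses.\<close>

lemma auto_is_act_unit:
  assumes f: "f \<in> auto K"
  obtains i j M u v where "i \<in> {1..<int q}" "j \<in> {0..<int q}" "M \<in> carrier (GL 2 p)"
    "u \<in> {0..<int p}" "v \<in> {0..<int p}" "f = act i j M u v"
proof -
  let ?\<M> = "mat_mod_monoid 2 p"
  interpret monoid ?\<M> by (rule mat_mod_monoid_is_monoid) simp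
  have inverse: "M \<otimes>\<^bsub>?\<M>\<^esub> M' = \<one>\<^bsub>?\<M>\<^esub> \<and> i * i' mod int q = 1"
    if id: "\<And>k. k \<in> carrier K \<Longrightarrow> act i j M u v (act i' j' M' u' v' k) = k"
      and M: "M \<in> carrier ?\<M>" "M' \<in> carrier ?\<M>" for i j M u v i' j' M' u' v'
  proof -
    have "act (i * i' mod int q) ((j + i * j') mod int q) (M \<otimes>\<^bsub>?\<M>\<^esub> M')
      ((u + (M $$ (0, 0) * u' + M $$ (0, 1) * v') mod int p) mod int p)
      ((v + (M $$ (1, 0) * u' + M $$ (1, 1) * v') mod int p) mod int p) k = act 1 0 \<one>\<^bsub>?\<M>\<^esub> 0 0 k"
      if "k \<in> carrier K" for k
      unfolding act_act[OF M[THEN carrier_mat_mod_monoid] that, symmetric] act_one[OF that]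
      by (rule id[OF that])
    then have "i * i' mod int q = 1 \<and> (j + i * j') mod int q = 0 \<and> M \<otimes>\<^bsub>?\<M>\<^esub> M' = \<one>\<^bsub>?\<M>\<^esub> \<and>
      (u + (M $$ (0, 0) * u' + M $$ (0, 1) * v') mod int p) mod int p = 0 \<and>
      (v + (M $$ (1, 0) * u' + M $$ (1, 1) * v') mod int p) mod int p = 0"
      by (rule act_inject) (use M q_gt_1 in simp_all)
    then show ?thesis by blast
  qed
  obtain f' where f': "f' \<in> auto K" "\<forall>k\<in>carrier K. f (f' k) = k" "\<forall>k\<in>carrier K. f' (f k) = k"
    by (rule auto_K_inverse[OF f])
  obtain i j M u v where 1: "i \<in> {0..<int q}" "j \<in> {0..<int q}" "M \<in> carrier ?\<M>"
    "u \<in> {0..<int p}" "v \<in> {0..<int p}" "f = act i j M u v"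
    using auto_is_act[OF f] .
  obtain i' j' M' u' v' where 2: "i' \<in> {0..<int q}" "j' \<in> {0..<int q}" "M' \<in> carrier ?\<M>"
    "u' \<in> {0..<int p}" "v' \<in> {0..<int p}" "f' = act i' j' M' u' v'"
    using auto_is_act[OF f'(1)] .
  note 3 = inverse[OF f'(2)[rule_format, unfolded 1(6) 2(6)] 1(3) 2(3)] inverse[OF f'(3)[rule_format, unfolded 1(6) 2(6)] 2(3) 1(3)]
  have "M \<in> carrier (GL 2 p)"
    using 1(3) 2(3) 3 by (auto simp: GL_def units_of_def Units_def)
  moreover have "i \<noteq> 0" using 3 by auto
  ultimately show thesis using that[of i j M u v] 1 by simp
qed

lemma AutoGroup_K:
  "\<exists>\<theta> \<in> hom (integer_mod_group (q - 1)) (AutoGroup (integer_mod_group q)).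
   \<exists>\<phi> \<in> hom (GL 2 p \<times>\<times> semidirect (integer_mod_group q) (integer_mod_group (q - 1)) \<theta>) (AutoGroup V).
     semidirect V (GL 2 p \<times>\<times> semidirect (integer_mod_group q) (integer_mod_group (q - 1)) \<theta>) \<phi> \<cong> AutoGroup K"
proof -
  let ?Zq = "integer_mod_group q" and ?Zq1 = "integer_mod_group (q - 1)" and ?\<M> = "mat_mod_monoid 2 p"
  obtain e :: "int \<Rightarrow> int" where e_all: "\<forall>k. e k \<in> {0..<int q}" "e 0 = 1"
    "\<forall>k\<ge>0. \<forall>l\<ge>0. e ((k + l) mod int (q - 1)) = e k * e l mod int q"
    "inj_on e {0..<int (q - 1)}"
    "\<forall>i\<in>{1..<int q}. \<exists>k\<in>{0..<int (q - 1)}. e k = i"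
    by (rule prime_exp_mod[OF prime_q])
  note e = e_all[rule_format]
  have carr_q: "carrier ?Zq = {0..<int q}" "carrier ?Zq1 = {0..<int (q - 1)}"
    using prime_gt_1_nat[OF prime_q] by (auto simp: carrier_integer_mod_group)
  have GL: "M \<in> carrier ?\<M>" "M \<in> carrier_mat 2 2" if "M \<in> carrier (GL 2 p)" for M
    using that by (auto simp: GL_def units_of_def Units_def mat_mod_monoid_def)
  have mult_GL: "M \<otimes>\<^bsub>GL 2 p\<^esub> M' = M \<otimes>\<^bsub>?\<M>\<^esub> M'" and one_GL: "\<one>\<^bsub>GL 2 p\<^esub> = \<one>\<^bsub>?\<M>\<^esub>" for M M'
    by (simp_all add: GL_def units_of_def)
  \<comment> \<open>With \<open>i = e k\<close>, the composition law of \<open>act\<close> dictates both actions: \<open>\<theta>\<close> is multiplication by \<open>i\<close>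
    on the \<open>j\<close>, and \<open>\<phi>\<close> is the action of \<open>M\<close> on the translation parameters.\<close>
  define \<theta> where "\<theta> k = (\<lambda>j\<in>{0..<int q}. e k * j mod int q)" for k
  define \<phi> :: "int mat \<times> int \<times> int \<Rightarrow> int \<times> int \<Rightarrow> int \<times> int" where
    "\<phi> = (\<lambda>(M, _). \<lambda>(u, v)\<in>carrier V.
       ((M $$ (0, 0) * u + M $$ (0, 1) * v) mod int p, (M $$ (1, 0) * u + M $$ (1, 1) * v) mod int p))"
  define \<Phi> :: "(int \<times> int) \<times> int mat \<times> int \<times> int \<Rightarrow> _" where
    "\<Phi> = (\<lambda>((u, v), M, j, k). act (e k) j M u v)"
  have \<theta>: "\<theta> \<in> hom ?Zq1 (AutoGroup ?Zq)"
  proof (rule hom_AutoGroupI)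
    fix k assume "k \<in> carrier ?Zq1"
    show "\<theta> k \<in> hom ?Zq ?Zq"
      by (rule homI) (simp_all add: carr_q \<theta>_def mod_simps distrib_left)
  next
    fix k k' j assume "k \<in> carrier ?Zq1" "k' \<in> carrier ?Zq1" "j \<in> carrier ?Zq"
    then have "0 \<le> k" "0 \<le> k'" "j \<in> {0..<int q}" by (auto simp only: carr_q atLeastLessThan_iff)
    then show "\<theta> (k \<otimes>\<^bsub>?Zq1\<^esub> k') j = \<theta> k (\<theta> k' j)"
      unfolding mult_integer_mod_group \<theta>_def e(3)[OF \<open>0 \<le> k\<close> \<open>0 \<le> k'\<close>]
      by (simp add: mod_simps mult.assoc)
  qed (auto simp: \<theta>_def carr_q e(2))
  define S where "S = semidirect ?Zq ?Zq1 \<theta>"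
  have S_group: "group S"
    unfolding S_def by (rule semidirect_is_group[OF _ _ \<theta>]) simp_all
  have S: "carrier S = {0..<int q} \<times> {0..<int (q - 1)}" "\<one>\<^bsub>S\<^esub> = (0, 0)"
    unfolding S_def semidirect_def carr_q by simp_all
  have mult_S: "(j, k) \<otimes>\<^bsub>S\<^esub> (j', k') = ((j + e k * j') mod int q, (k + k') mod int (q - 1))"
    if "j' \<in> {0..<int q}" for j k j' k'
    using that by (simp add: S_def semidirect_def \<theta>_def mod_simps)
  define H where "H = GL 2 p \<times>\<times> S"
  have GL_group: "group (GL 2 p)" by (rule GL_is_group) simp
  have H_group: "group H" unfolding H_def by (rule DirProd_group[OF GL_group S_group])
  have \<phi>_apply: "\<phi> (M, z) (u, v) =
      ((M $$ (0, 0) * u + M $$ (0, 1) * v) mod int p, (M $$ (1, 0) * u + M $$ (1, 1) * v) mod int p)"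
    if "u \<in> {0..<int p}" "v \<in> {0..<int p}" for M z u v
    using that by (simp add: \<phi>_def carrier_V)
  have \<phi>: "\<phi> \<in> hom H (AutoGroup V)"
  proof (rule hom_AutoGroupI)
    fix h assume "h \<in> carrier H"
    obtain M z where h: "h = (M, z)" by (metis surj_pair)
    show "\<phi> h \<in> extensional (carrier V)" by (simp add: h \<phi>_def)
    have lin: "(a * ((u + u') mod int p) + b * ((v + v') mod int p)) mod int p =
        ((a * u + b * v) mod int p + (a * u' + b * v') mod int p) mod int p" for a b u v u' v'
      by (rule mod_eqI, simp only: expand_mod) (auto simp: algebra_simps intro!: dvd_add dvd_diff)
    show "\<phi> h \<in> hom V V"
      by (rule homI) (auto simp: h carrier_V \<phi>_apply lin)
  next
    fix n assume "n \<in> carrier V"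
    then show "\<phi> \<one>\<^bsub>H\<^esub> n = n"
      using p_gt_1 by (auto simp: H_def carrier_V \<phi>_apply one_GL one_mat_mod_monoid_2)
  next
    fix h h' n assume hh': "h \<in> carrier H" "h' \<in> carrier H" "n \<in> carrier V"
    obtain M z M' z' u v where eqs: "h = (M, z)" "h' = (M', z')" "n = (u, v)" by (metis surj_pair)
    have comp: "((a * a' + b * c') mod int p * u + (a * b' + b * d') mod int p * v) mod int p =
        (a * ((a' * u + b' * v) mod int p) + b * ((c' * u + d' * v) mod int p)) mod int p" for a b a' b' c' d'
      by (rule mod_eqI, simp only: expand_mod) (auto simp: algebra_simps intro!: dvd_add dvd_diff)
    show "\<phi> (h \<otimes>\<^bsub>H\<^esub> h') n = \<phi> h (\<phi> h' n)"
      using hh' by (simp add: eqs H_def carrier_V \<phi>_apply mult_GL mult_mat_mod_monoid_2 GL comp)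
  qed (rule H_group group_V)+
  define T where "T = semidirect V H \<phi>"
  have T_group: "group T"
    unfolding T_def by (rule semidirect_is_group[OF group_V H_group \<phi>])
  have T: "carrier T = ({0..<int p} \<times> {0..<int p}) \<times> carrier (GL 2 p) \<times> {0..<int q} \<times> {0..<int (q - 1)}"
    by (simp add: T_def semidirect_def carrier_V H_def S)
  have hom: "\<Phi> \<in> hom T (AutoGroup K)"
  proof (rule hom_AutoGroupI)
    fix \<tau> assume "\<tau> \<in> carrier T"
    show "\<Phi> \<tau> \<in> hom K K" "\<Phi> \<tau> \<in> extensional (carrier K)"
      by (cases \<tau>; auto simp: \<Phi>_def act_hom; simp add: act_def)+
  next
    fix k assume "k \<in> carrier K"
    then show "\<Phi> \<one>\<^bsub>T\<^esub> k = k"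
      by (simp add: T_def semidirect_def H_def S one_GL \<Phi>_def e(2) act_one)
  next
    fix \<tau> \<tau>' k assume \<tau>: "\<tau> \<in> carrier T" "\<tau>' \<in> carrier T" and k: "k \<in> carrier K"
    obtain u v M j l u' v' M' j' l' where eqs: "\<tau> = ((u, v), M, j, l)" "\<tau>' = ((u', v'), M', j', l')"
      by (metis surj_pair)
    have "u' \<in> {0..<int p}" "v' \<in> {0..<int p}" "j' \<in> {0..<int q}"
      using \<tau>(2) unfolding eqs T by simp_all
    then have "\<tau> \<otimes>\<^bsub>T\<^esub> \<tau>' = (((u + (M $$ (0, 0) * u' + M $$ (0, 1) * v') mod int p) mod int p,
        (v + (M $$ (1, 0) * u' + M $$ (1, 1) * v') mod int p) mod int p),
        M \<otimes>\<^bsub>?\<M>\<^esub> M', (j + e l * j') mod int q, (l + l') mod int (q - 1))"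
      by (simp add: eqs T_def semidirect_def H_def mult_S \<phi>_apply mult_GL)
    then show "\<Phi> (\<tau> \<otimes>\<^bsub>T\<^esub> \<tau>') k = \<Phi> \<tau> (\<Phi> \<tau>' k)"
      using \<tau> k by (simp add: eqs T \<Phi>_def act_act GL e(3)[unfolded One_nat_def] del: of_nat_diff)
  qed (rule T_group K.is_group)+
  have "bij_betw \<Phi> (carrier T) (carrier (AutoGroup K))"
  proof (rule bij_betw_imageI)
    show "inj_on \<Phi> (carrier T)"
    proof (rule inj_onI)
      fix \<tau> \<tau>' assume \<tau>: "\<tau> \<in> carrier T" "\<tau>' \<in> carrier T" "\<Phi> \<tau> = \<Phi> \<tau>'"
      obtain u v M j l u' v' M' j' l' where eqs: "\<tau> = ((u, v), M, j, l)" "\<tau>' = ((u', v'), M', j', l')"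
        by (metis surj_pair)
      have \<tau>_mem: "u \<in> {0..<int p}" "v \<in> {0..<int p}" "M \<in> carrier (GL 2 p)" "j \<in> {0..<int q}"
        "l \<in> {0..<int (q - 1)}" and \<tau>'_mem: "u' \<in> {0..<int p}" "v' \<in> {0..<int p}"
        "M' \<in> carrier (GL 2 p)" "j' \<in> {0..<int q}" "l' \<in> {0..<int (q - 1)}"
        using \<tau>(1,2) unfolding eqs T by blast+
      have "e l = e l' \<and> j = j' \<and> M = M' \<and> u = u' \<and> v = v'"
      proof (rule act_inject)
        show "act (e l) j M u v k = act (e l') j' M' u' v' k" for k
          using \<tau>(3) by (simp add: eqs \<Phi>_def)
      qed (fact e(1) GL(1)[OF \<tau>_mem(3)] GL(1)[OF \<tau>'_mem(3)] \<tau>_mem \<tau>'_mem)+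
      moreover from this have "l = l'"
        using inj_onD[OF e(4) _ \<tau>_mem(5) \<tau>'_mem(5)] by blast
      ultimately show "\<tau> = \<tau>'" by (simp add: eqs)
    qed
    have "f \<in> \<Phi> ` carrier T" if aut: "f \<in> auto K" for f
    proof -
      obtain i j M u v where f: "i \<in> {1..<int q}" "j \<in> {0..<int q}" "M \<in> carrier (GL 2 p)"
        "u \<in> {0..<int p}" "v \<in> {0..<int p}" "f = act i j M u v"
        using auto_is_act_unit[OF aut] .
      obtain k where "k \<in> {0..<int (q - 1)}" "e k = i" using e(5)[OF f(1)] by blast
      then show ?thesis
        using f unfolding T by (intro image_eqI[of _ _ "((u, v), M, j, k)"]) (simp_all add: \<Phi>_def)
    qed
    then show "\<Phi> ` carrier T = carrier (AutoGroup K)"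
      using hom by (auto simp: hom_def AutoGroup_def)
  qed
  then have "T \<cong> AutoGroup K" using hom by (intro is_isoI isoI)
  then show ?thesis
    using \<theta> \<phi> unfolding T_def H_def S_def by blast
qed

end

theorem mainTheorem15:
  fixes p q :: nat and r :: int
  assumes "prime p" and "prime q" and "p \<noteq> q" and "p * q \<noteq> 6" and "q dvd p - 1"
    and "[r ^ q = 1] (mod int p)" and "\<not> [r = 1] (mod int p)"
  shows "\<exists>\<theta> \<in> hom (integer_mod_group (q - 1)) (AutoGroup (integer_mod_group q)).
         \<exists>\<phi> \<in> hom (GL 2 p \<times>\<times> semidirect (integer_mod_group q) (integer_mod_group (q - 1)) \<theta>)
                  (AutoGroup (integer_mod_group p \<times>\<times> integer_mod_group p)).
           AutoGroup (G_pres p q r) \<cong>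
             semidirect (integer_mod_group p \<times>\<times> integer_mod_group p)
               (GL 2 p \<times>\<times> semidirect (integer_mod_group q) (integer_mod_group (q - 1)) \<theta>) \<phi>"
proof -
  interpret scalar_ext p q r using assms by unfold_locales
  obtain f where "f \<in> iso (G_pres p q r) K" using G_pres_iso_K by blast
  then have G_K: "AutoGroup (G_pres p q r) \<cong> AutoGroup K"
    by (intro AutoGroup_cong K.is_group) (simp_all add: G_pres_def presented_group_is_group)
  obtain \<theta> \<phi> where \<theta>: "\<theta> \<in> hom (integer_mod_group (q - 1)) (AutoGroup (integer_mod_group q))"
    and \<phi>: "\<phi> \<in> hom (GL 2 p \<times>\<times> semidirect (integer_mod_group q) (integer_mod_group (q - 1)) \<theta>) (AutoGroup V)"
    and iso: "semidirect V (GL 2 p \<times>\<times> semidirect (integer_mod_group q) (integer_mod_group (q - 1)) \<theta>) \<phi> \<cong> AutoGroup K"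
    using AutoGroup_K by blast
  have "group (semidirect V (GL 2 p \<times>\<times> semidirect (integer_mod_group q) (integer_mod_group (q - 1)) \<theta>) \<phi>)"
    by (intro semidirect_is_group group_V DirProd_group GL_is_group group_integer_mod_group \<theta> \<phi> p_pos)
  then show ?thesis
    using \<theta> \<phi> iso_trans[OF G_K group.iso_sym[OF _ iso]] by blast
qed

end
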